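(* Let $D\subset\mathbb{C}$ be open, simply connected and contain $0$, and let $f:D\to\mathbb{H}^3$ be a conformal immersion with metric $e^{2u}dz\,d\bar z$, Hopf differential $Q\,dz^2$ and constant mean curvature $H$ with $|H|>1$. Let $h(z):=u(z,0)$ be the holomorphic part of $u(z,\bar z)$. Then the normalized potential corresponding to $f$ is $$P=\begin{pmatrix}0&-e^{-2h(z)+h(0)}\,Q\\ \frac12e^{2h(z)-h(0)}\sqrt{H^2-1}&0\end{pmatrix}dz .$$
   Context: $\mathbb{H}^3$ is hyperbolic 3-space of curvature $-1$ in $\mathbb{R}^{3,1}$. For the conformal immersion $f$ with unit normal $N$: $\langle f_z,f_z\rangle=0$, $\langle f_z,f_{\bar z}\rangle=\frac12e^{2u}$ with $u$ real, $Q=\langle f_{zz},N\rangle$, $\langle f_{z\bar z},N\rangle=\frac12He^{2u}$; the Gauss–Codazzi equations are $u_{z\bar z}-\frac{e^{2u}}4(1-H^2)-e^{-2u}Q\overline Q=0$, $Q_{\bar z}=0$. The holomorphic part $h(z)=u(z,0)$ is obtained from the real analytic function $u(z,\bar z)$ by treating $z,\bar z$ as independent variables and setting $\bar z=0$. Let $\sigma_3=\mathrm{diag}(1,-1)$. $\Lambda\mathrm{SL}(2,\mathbb{C})$ is the group of loops $g:S^1\to\mathrm{SL}(2,\mathbb{C})$ with $g(-\theta)=\sigma_3g(\theta)\sigma_3^{-1}$; $\Lambda\mathrm{SU}(2)$ its subgroup of $\mathrm{SU}(2)$-valued loops; $\Lambda_+\mathrm{SL}(2,\mathbb{C})$ the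 loops extending holomorphically to the unit disk; $\Lambda_-^*\mathrm{SL}(2,\mathbb{C})$ the loops extending holomorphically to the exterior of the unit disk and equal to $I$ at $\infty$. The adjusted frame $\tilde F(z,\theta)\in\Lambda\mathrm{SU}(2)$ of $f$ is the solution with $\tilde F(0,\theta)=I$ of $\tilde F^{-1}d\tilde F=\tilde\Omega$, where $\tilde\Omega$ is the adjusted Maurer–Cartan form $$\tilde\Omega=\begin{pmatrix}-\frac12u_z&-\theta^{-1}e^{-u}Q\\ \theta^{-1}\frac12e^u\sqrt{H^2-1}&\frac12u_z\end{pmatrix}dz+\begin{pmatrix}\frac12u_{\bar z}&-\theta\frac12e^u\sqrt{H^2-1}\\ \theta e^{-u}\overline Q&-\frac12u_{\bar z}\end{pmatrix}d\bar z .$$ There is a discrete set $S\subset D\setminus\{0\}$ such that on $D\setminus S$ one has $\tilde F=\tilde F_-\tilde F_+$ with $\tilde F_-\in\Lambda_-^*\mathrm{SL}(2,\mathbb{C})$, $\tilde F_+\in\Lambda_+\mathrm{SL}(2,\mathbb{C})$. The normalized potential corresponding to $f$ is the meromorphic $(1,0)$-form $P=\theta\,\tilde F_-^{-1}d\tilde F_-$. *)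

theory Defs
  imports "HOL-Complex_Analysis.Complex_Analysis"
begin

section \<open>Smooth maps and Wirtinger derivatives\<close>

fun Ck_on :: "nat \<Rightarrow> complex set \<Rightarrow> (complex \<Rightarrow> 'a::real_normed_vector) \<Rightarrow> bool" where
  "Ck_on 0 D g \<longleftrightarrow> continuous_on D g"
| "Ck_on (Suc k) D g \<longleftrightarrow>
     (\<exists>gx gy. (\<forall>z\<in>D. (g has_derivative (\<lambda>v. Re v *\<^sub>R gx z + Im v *\<^sub>R gy z)) (at z))
        \<and> Ck_on k D gx \<and> Ck_on k D gy)"

definition smooth_on :: "complex set \<Rightarrow> (complex \<Rightarrow> 'a::real_normed_vector) \<Rightarrow> bool" where
  "smooth_on D g \<longleftrightarrow> (\<forall>k. Ck_on k D g)"

definition wirt :: "(complex \<Rightarrow> complex) \<Rightarrow> complex \<Rightarrow> complex" where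
  "wirt g z = (frechet_derivative g (at z) 1 - \<i> * frechet_derivative g (at z) \<i>) / 2"

definition wirt_bar :: "(complex \<Rightarrow> complex) \<Rightarrow> complex \<Rightarrow> complex" where
  "wirt_bar g z = (frechet_derivative g (at z) 1 + \<i> * frechet_derivative g (at z) \<i>) / 2"

definition vwirt :: "(complex \<Rightarrow> complex^4) \<Rightarrow> complex \<Rightarrow> complex^4" where
  "vwirt g z = (\<chi> i. wirt (\<lambda>w. g w $ i) z)"

definition vwirt_bar :: "(complex \<Rightarrow> complex^4) \<Rightarrow> complex \<Rightarrow> complex^4" where
  "vwirt_bar g z = (\<chi> i. wirt_bar (\<lambda>w. g w $ i) z)"

definition cvec :: "real^4 \<Rightarrow> complex^4" where
  "cvec x = (\<chi> i. of_real (x $ i))"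


section \<open>Conformal immersions into hyperbolic space\<close>

text \<open>The form of signature (3,1). On \<^typ>\<open>complex^4\<close> it is the complex bilinear
  (not Hermitian) extension.\<close>

definition lorentz :: "('a::comm_ring_1)^4 \<Rightarrow> 'a^4 \<Rightarrow> 'a" where
  "lorentz x y = x$1 * y$1 + x$2 * y$2 + x$3 * y$3 - x$4 * y$4"

definition hyperbolic3 :: "(real^4) set" where
  "hyperbolic3 = {x. lorentz x x = -1 \<and> x$4 > 0}"

text \<open>The metric is \<open>e\<^sup>2\<^sup>u dz d\<bar>z\<close>; it is nondegenerate, so \<open>f\<close> is an immersion.\<close>

definition conformal_immersion ::
    "complex set \<Rightarrow> (complex \<Rightarrow> real^4) \<Rightarrow> (complex \<Rightarrow> real) \<Rightarrow> bool" where
  "conformal_immersion D f u \<longleftrightarrow>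
     smooth_on D f \<and>
     (\<forall>z\<in>D. f z \<in> hyperbolic3
        \<and> lorentz (vwirt (cvec \<circ> f) z) (vwirt (cvec \<circ> f) z) = 0
        \<and> lorentz (vwirt (cvec \<circ> f) z) (vwirt_bar (cvec \<circ> f) z) = of_real (exp (2 * u z) / 2))"

text \<open>Either choice of the sign of the normal is allowed.\<close>

definition unit_normal ::
    "complex set \<Rightarrow> (complex \<Rightarrow> real^4) \<Rightarrow> (complex \<Rightarrow> real^4) \<Rightarrow> bool" where
  "unit_normal D f N \<longleftrightarrow>
     smooth_on D N \<and>
     (\<forall>z\<in>D. lorentz (N z) (N z) = 1 \<and> lorentz (N z) (f z) = 0
        \<and> (\<forall>v. lorentz (N z) (frechet_derivative f (at z) v) = 0))"

definition hopf :: "(complex \<Rightarrow> real^4) \<Rightarrow> (complex \<Rightarrow> real^4) \<Rightarrow> complex \<Rightarrow> complex" where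
  "hopf f N z = lorentz (vwirt (vwirt (cvec \<circ> f)) z) (cvec (N z))"

definition has_mean_curvature ::
    "complex set \<Rightarrow> (complex \<Rightarrow> real^4) \<Rightarrow> (complex \<Rightarrow> real^4) \<Rightarrow> (complex \<Rightarrow> real)
       \<Rightarrow> (complex \<Rightarrow> real) \<Rightarrow> bool" where
  "has_mean_curvature D f N u H \<longleftrightarrow>
     (\<forall>z\<in>D. lorentz (vwirt_bar (vwirt (cvec \<circ> f)) z) (cvec (N z))
              = of_real (H z * exp (2 * u z) / 2))"

text \<open>The holomorphic part \<open>h(z) = u(z,0)\<close>. The extension \<open>U(z,w)\<close> of \<open>u\<close> to independent
  variables exists a priori only near the diagonal \<open>w = \<bar>z\<close>, so \<open>U(z,0)\<close> makes sense for \<open>z\<close>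
  near 0; \<open>h\<close> is this germ at 0, continued holomorphically to a domain \<open>V\<close>.
  (Jointly continuous and separately holomorphic functions are holomorphic.)\<close>

definition holomorphic_part ::
    "complex set \<Rightarrow> (complex \<Rightarrow> real) \<Rightarrow> complex set \<Rightarrow> (complex \<Rightarrow> complex) \<Rightarrow> bool" where
  "holomorphic_part D u V h \<longleftrightarrow>
     open V \<and> connected V \<and> 0 \<in> V \<and> V \<subseteq> D \<and> h holomorphic_on V \<and>
     (\<exists>e>0. \<exists>U :: complex \<Rightarrow> complex \<Rightarrow> complex. ball 0 e \<subseteq> V
        \<and> continuous_on (ball 0 e \<times> ball 0 e) (\<lambda>(z, w). U z w)
        \<and> (\<forall>w\<in>ball 0 e. (\<lambda>z. U z w) holomorphic_on ball 0 e)
        \<and> (\<forall>z\<in>ball 0 e. (\<lambda>w. U z w) holomorphic_on ball 0 e)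
        \<and> (\<forall>z\<in>ball 0 e. U z (cnj z) = of_real (u z))
        \<and> (\<forall>z\<in>ball 0 e. h z = U z 0))"


section \<open>Loop groups\<close>

type_synonym cmat2 = "complex^2^2"

definition mat2 :: "complex \<Rightarrow> complex \<Rightarrow> complex \<Rightarrow> complex \<Rightarrow> cmat2" where
  "mat2 a b c d = vector [vector [a, b], vector [c, d]]"

definition cscale :: "complex \<Rightarrow> cmat2 \<Rightarrow> cmat2" where
  "cscale c M = (\<chi> i j. c * M $ i $ j)"

definition ctranspose :: "cmat2 \<Rightarrow> cmat2" where
  "ctranspose M = (\<chi> i j. cnj (M $ j $ i))"

definition sigma3 :: cmat2 where
  "sigma3 = mat2 1 0 0 (-1)"

text \<open>Loops are continuous, given by functions on \<^typ>\<open>complex\<close> of which only the values on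
  the unit circle matter. Extensions to the disk or its exterior are continuous up to
  the circle; by the maximum principle their determinant is 1 as well.\<close>

definition LambdaSL :: "(complex \<Rightarrow> cmat2) set" where
  "LambdaSL = {g. continuous_on (sphere 0 1) g
      \<and> (\<forall>\<theta>\<in>sphere 0 1. det (g \<theta>) = 1)
      \<and> (\<forall>\<theta>\<in>sphere 0 1. g (- \<theta>) = sigma3 ** g \<theta> ** matrix_inv sigma3)}"

definition LambdaSU :: "(complex \<Rightarrow> cmat2) set" where
  "LambdaSU = {g \<in> LambdaSL. \<forall>\<theta>\<in>sphere 0 1. g \<theta> ** ctranspose (g \<theta>) = mat 1}"

definition LambdaPlusSL :: "(complex \<Rightarrow> cmat2) set" where
  "LambdaPlusSL = {g \<in> LambdaSL. \<exists>G :: complex \<Rightarrow> cmat2.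
      continuous_on (cball 0 1) G
      \<and> (\<forall>i j. (\<lambda>\<theta>. G \<theta> $ i $ j) holomorphic_on ball 0 1)
      \<and> (\<forall>\<theta>\<in>sphere 0 1. G \<theta> = g \<theta>)}"

definition LambdaMinusStarSL :: "(complex \<Rightarrow> cmat2) set" where
  "LambdaMinusStarSL = {g \<in> LambdaSL. \<exists>G :: complex \<Rightarrow> cmat2.
      continuous_on (- ball 0 1) G
      \<and> (\<forall>i j. (\<lambda>\<theta>. G \<theta> $ i $ j) holomorphic_on - cball 0 1)
      \<and> (\<forall>\<theta>\<in>sphere 0 1. G \<theta> = g \<theta>)
      \<and> (G \<longlongrightarrow> mat 1) at_infinity}"


section \<open>Adjusted frame and normalized potential\<close>

text \<open>The form \<open>g\<inverse> dg\<close> at the point \<open>z\<close>, evaluated on the tangent vector \<open>v\<close>.\<close>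

definition maurer_cartan :: "(complex \<Rightarrow> cmat2) \<Rightarrow> complex \<Rightarrow> complex \<Rightarrow> cmat2" where
  "maurer_cartan g z v = matrix_inv (g z) ** frechet_derivative g (at z) v"

text \<open>The adjusted Maurer--Cartan form at \<open>z\<close> on the tangent vector \<open>v\<close>, that is, with
  \<open>dz(v) = v\<close> and \<open>d\<bar>z(v) = cnj v\<close>.\<close>

definition adjusted_form ::
    "(complex \<Rightarrow> real) \<Rightarrow> (complex \<Rightarrow> complex) \<Rightarrow> real \<Rightarrow> complex \<Rightarrow> complex \<Rightarrow> complex \<Rightarrow> cmat2" where
  "adjusted_form u Q H \<theta> z v =
     (let uz = wirt (\<lambda>w. of_real (u w)) z;
          uzb = wirt_bar (\<lambda>w. of_real (u w)) z;
          s = of_real (sqrt (H\<^sup>2 - 1))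
      in cscale v
           (mat2 (- uz / 2) (- inverse \<theta> * of_real (exp (- u z)) * Q z)
                 (inverse \<theta> * of_real (exp (u z)) / 2 * s) (uz / 2))
         + cscale (cnj v)
           (mat2 (uzb / 2) (- \<theta> * of_real (exp (u z)) / 2 * s)
                 (\<theta> * of_real (exp (- u z)) * cnj (Q z)) (- uzb / 2)))"

definition adjusted_frame ::
    "complex set \<Rightarrow> (complex \<Rightarrow> real) \<Rightarrow> (complex \<Rightarrow> complex) \<Rightarrow> real
       \<Rightarrow> (complex \<Rightarrow> complex \<Rightarrow> cmat2) \<Rightarrow> bool" where
  "adjusted_frame D u Q H F \<longleftrightarrow>
     (\<forall>z\<in>D. F z \<in> LambdaSU) \<and>
     (\<forall>\<theta>\<in>sphere 0 1. F 0 \<theta> = mat 1) \<and>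
     (\<forall>z\<in>D. \<forall>\<theta>\<in>sphere 0 1.
        (\<lambda>\<zeta>. F \<zeta> \<theta>) differentiable (at z)
        \<and> (\<forall>v. maurer_cartan (\<lambda>\<zeta>. F \<zeta> \<theta>) z v = adjusted_form u Q H \<theta> z v))"

text \<open>\<open>P z \<theta>\<close> is the coefficient of \<open>dz\<close> of the form \<open>\<theta> F\<^sub>-\<inverse> dF\<^sub>-\<close>; a priori it may
  depend on \<open>\<theta>\<close>. Discreteness of \<open>S\<close> means having no accumulation point in \<open>D\<close>, so that \<open>D - S\<close>
  is open. The first factor depends continuously on the point, as a loop; since \<open>F\<close> does,
  so does the second.\<close>

definition normalized_potential ::
    "complex set \<Rightarrow> complex set \<Rightarrow> (complex \<Rightarrow> complex \<Rightarrow> cmat2)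
       \<Rightarrow> (complex \<Rightarrow> complex \<Rightarrow> cmat2) \<Rightarrow> bool" where
  "normalized_potential D S F P \<longleftrightarrow>
     S \<subseteq> D - {0} \<and> S sparse_in D \<and>
     (\<forall>\<theta>\<in>sphere 0 1. \<forall>i j. (\<lambda>z. P z \<theta> $ i $ j) meromorphic_on D) \<and>
     (\<exists>Fm Fp :: complex \<Rightarrow> complex \<Rightarrow> cmat2.
        continuous_on ((D - S) \<times> sphere 0 1) (\<lambda>(z, \<theta>). Fm z \<theta>) \<and>
        (\<forall>z\<in>D - S. Fm z \<in> LambdaMinusStarSL \<and> Fp z \<in> LambdaPlusSL) \<and>
        (\<forall>z\<in>D - S. \<forall>\<theta>\<in>sphere 0 1.
           F z \<theta> = Fm z \<theta> ** Fp z \<theta>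
           \<and> (\<lambda>\<zeta>. Fm \<zeta> \<theta>) differentiable (at z)
           \<and> (\<forall>v. cscale \<theta> (maurer_cartan (\<lambda>\<zeta>. Fm \<zeta> \<theta>) z v) = cscale v (P z \<theta>))))"

end

theory Submission
  imports Defs
begin

text \<open>
  Write \<open>F = F\<^sub>- F\<^sub>+\<close> for the splitting of the frame, \<open>\<Omega>'\<close> for the \<open>dz\<close> part of the adjusted form and
  \<open>s = sqrt (H\<^sup>2 - 1)\<close>. Since \<open>F\<^sub>-\<inverse> dF\<^sub>- = \<theta>\<inverse> P dz\<close>, the frame equation becomes
  \<open>\<partial>\<^sub>z F\<^sub>+ = F\<^sub>+ \<Omega>' - \<theta>\<inverse> P F\<^sub>+\<close>. Solved for \<open>P\<close> it shows that \<open>P\<close> extends holomorphically in \<open>\<theta>\<close> to the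
  disk, while \<open>P = \<theta> F\<^sub>-\<inverse> \<partial>\<^sub>z F\<^sub>-\<close> shows that \<open>P\<close> extends to its exterior, including infinity; so \<open>P\<close> does
  not depend on \<open>\<theta>\<close> (\<open>P_const\<close>). By the twisting and \<open>det F\<^sub>+ = 1\<close>, the value of \<open>F\<^sub>+\<close> at \<open>\<theta> = 0\<close> is
  \<open>diag(\<alpha>, 1/\<alpha>)\<close>, and the coefficient of \<open>\<theta>\<inverse>\<close> in the equation for \<open>F\<^sub>+\<close> gives \<open>P\<close> as the conjugate by
  this matrix of the \<open>\<theta>\<inverse>\<close> part of \<open>\<Omega>'\<close>: it is off-diagonal with entries \<open>-Q/p\<close> and \<open>p s/2\<close>, where
  \<open>p = e\<^sup>u/\<alpha>\<^sup>2\<close> (\<open>P_entries\<close>, \<open>P_eq\<close>). As \<open>F\<^sub>-\<close> is holomorphic in \<open>z\<close>, so are \<open>P\<close> and \<open>p\<close>.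

  It remains to identify \<open>p\<close>, and for this the substitution \<open>\<bar>z = 0\<close> is replaced by a comparison of
  \<open>\<partial>\<^sub>z\<close>-jets at the origin. Let \<open>G\<^sub>k\<close> be the coefficient of \<open>\<theta>\<^sup>k\<close> in \<open>F\<^sub>+ diag(e\<^bsup>u/2\<^esup>, e\<^bsup>-u/2\<^esup>)\<close>. This gauge
  removes the diagonal of \<open>\<Omega>'\<close>, and the equation for \<open>F\<^sub>+\<close> turns into the recursion
  \<open>\<partial>\<^sub>z G\<^sub>k = G\<^bsub>k+1\<^esub> B - P G\<^bsub>k+1\<^esub>\<close> with \<open>B\<close> the gauged \<open>\<theta>\<inverse>\<close> part. Because \<open>F = I\<close> at the origin, every
  \<open>G\<^sub>k\<close> with \<open>k \<ge> 1\<close> vanishes there, and by the recursion all derivatives \<open>\<partial>\<^sub>z\<^sup>n G\<^sub>0\<close> with \<open>n \<ge> 1\<close> vanish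
  there as well. The entry \<open>p (G\<^sub>0)\<^sub>1\<^sub>1 = e\<^sup>2\<^sup>u (G\<^sub>0)\<^sub>2\<^sub>2\<close> of the recursion for \<open>k = -1\<close> then says that \<open>e\<^bsup>u(0)\<^esup> p\<close>
  and \<open>e\<^sup>2\<^sup>u\<close> have the same \<open>\<partial>\<^sub>z\<close>-jet. On the other hand \<open>e\<^sup>2\<^sup>u\<close> and \<open>e\<^sup>2\<^sup>h\<close> have the same \<open>\<partial>\<^sub>z\<close>-jet, since
  \<open>\<partial>\<^sub>z\<close> of \<open>U(z, \<bar>z)\<close> only differentiates the first variable. So the holomorphic functions \<open>e\<^bsup>h(0)\<^esup> p\<close>
  and \<open>e\<^sup>2\<^sup>h\<close> agree near \<open>0\<close> (\<open>factor_eq_holomorphic_part\<close>), hence wherever both are defined, and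
  \<open>E = e\<^bsup>h(0)\<^esup> p\<close> continues \<open>e\<^sup>2\<^sup>h\<close> to all of \<open>D\<close>.
\<close>

section \<open>Real differentiability in Wirtinger coordinates\<close>

definition has_dz :: "(complex \<Rightarrow> complex) \<Rightarrow> complex \<Rightarrow> complex \<Rightarrow> complex \<Rightarrow> bool" where
  "has_dz f a b z \<longleftrightarrow> (f has_derivative (\<lambda>v. v * a + cnj v * b)) (at z)"

lemma has_dz_wirt:
  assumes "f differentiable (at z)"
  shows "has_dz f (wirt f z) (wirt_bar f z) z"
proof -
  let ?L = "frechet_derivative f (at z)"
  have L: "(f has_derivative ?L) (at z)"
    using assms by (simp add: frechet_derivative_works)
  have "?L v = v * wirt f z + cnj v * wirt_bar f z" for v
  proof -
    have "?L v = ?L (Re v *\<^sub>R 1 + Im v *\<^sub>R \<i>)"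
      by (simp add: complex_eq[symmetric] scaleR_conv_of_real mult.commute)
    also have "\<dots> = Re v *\<^sub>R ?L 1 + Im v *\<^sub>R ?L \<i>"
      using has_derivative_linear[OF L] by (simp only: linear_add linear_scale)
    also have "\<dots> = v * wirt f z + cnj v * wirt_bar f z"
    proof -
      have v: "complex_of_real (Re v) = (v + cnj v) / 2" "complex_of_real (Im v) = (v - cnj v) / (2*\<i>)"
        by (simp_all add: complex_eq_iff complex_add_cnj complex_diff_cnj)
      show ?thesis unfolding wirt_def wirt_bar_def scaleR_conv_of_real v
        by (simp add: field_simps)
    qed
    finally show ?thesis .
  qed
  then have "?L = (\<lambda>v. v * wirt f z + cnj v * wirt_bar f z)" by blast
  then show ?thesis using L by (simp add: has_dz_def)
qed

lemma has_dz_unique: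
  assumes "has_dz f a b z" "has_dz f a' b' z"
  shows "a = a'" "b = b'"
proof -
  have e: "(\<lambda>v. v * a + cnj v * b) = (\<lambda>v. v * a' + cnj v * b')"
    using assms unfolding has_dz_def by (rule has_derivative_unique)
  have 1: "a + b = a' + b'" using fun_cong[OF e, of 1] by simp
  have "\<i> * a - \<i> * b = \<i> * a' - \<i> * b'" using fun_cong[OF e, of \<i>] by simp
  then have "\<i> * (a - b) = \<i> * (a' - b')" by (simp add: algebra_simps)
  then have 2: "a - b = a' - b'" by simp
  have "2 * a = 2 * a'" using arg_cong2[OF 1 2, of "(+)"] by simp
  then show "a = a'" by simp
  with 1 show "b = b'" by simp
qed

lemma has_dz_cong:
  assumes "has_dz f a b z" "open W" "z \<in> W" "\<And>x. x \<in> W \<Longrightarrow> f x = g x"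
  shows "has_dz g a b z"
  using assms unfolding has_dz_def by (blast intro: has_derivative_transform_within_open)

lemma has_dz_continuous: "has_dz f a b z \<Longrightarrow> isCont f z"
  unfolding has_dz_def by (rule has_derivative_continuous)

lemma has_dz_const [simp]: "has_dz (\<lambda>_. c) 0 0 z"
  by (simp add: has_dz_def)

lemma has_dz_add:
  assumes "has_dz f a b z" "has_dz g a' b' z"
  shows "has_dz (\<lambda>x. f x + g x) (a + a') (b + b') z"
  using has_derivative_add[OF assms[unfolded has_dz_def]]
  by (simp add: has_dz_def algebra_simps)

lemma has_dz_diff:
  assumes "has_dz f a b z" "has_dz g a' b' z"
  shows "has_dz (\<lambda>x. f x - g x) (a - a') (b - b') z"
  using has_derivative_diff[OF assms[unfolded has_dz_def]]
  by (simp add: has_dz_def algebra_simps)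

lemma has_dz_mult:
  assumes "has_dz f a b z" "has_dz g a' b' z"
  shows "has_dz (\<lambda>x. f x * g x) (a * g z + f z * a') (b * g z + f z * b') z"
  using has_derivative_mult[OF assms[unfolded has_dz_def]]
  by (simp add: has_dz_def algebra_simps)

lemma has_dz_cmult:
  assumes "has_dz f a b z"
  shows "has_dz (\<lambda>x. c * f x) (c * a) (c * b) z"
  using has_dz_mult[OF has_dz_const assms, of c] by simp

lemma has_dz_holo:
  assumes "(f has_field_derivative a) (at z)"
  shows "has_dz f a 0 z"
proof -
  have "(*) a = (\<lambda>v. v * a)" by (auto simp: mult.commute)
  then show ?thesis
    using assms by (simp add: has_dz_def has_field_derivative_def)
qed

lemma has_dz_chain:
  assumes "has_dz f a b z" "(g has_field_derivative g') (at (f z))"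
  shows "has_dz (\<lambda>x. g (f x)) (g' * a) (g' * b) z"
  using has_derivative_compose[OF assms(1)[unfolded has_dz_def]
      has_field_derivative_imp_has_derivative[OF assms(2)]]
  by (simp add: has_dz_def algebra_simps)

lemma has_dz_imp_field:
  assumes "has_dz f a 0 z"
  shows "(f has_field_derivative a) (at z)"
proof -
  have "(\<lambda>v. v * a + cnj v * 0) = (*) a" by (auto simp: mult.commute)
  then show ?thesis using assms unfolding has_dz_def has_field_derivative_def by simp
qed

text \<open>Compactness of the parameter space makes the remainder in the definition of the derivative uniform in
  the parameter. This is what allows differentiation in \<open>z\<close> to commute with operations on loops.\<close>

lemma uniform_dz:
  fixes K :: "complex \<Rightarrow> 'b::metric_space \<Rightarrow> complex"
  assumes A: "open A" and T: "compact T"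
    and d: "\<And>z t. z \<in> A \<Longrightarrow> t \<in> T \<Longrightarrow> has_dz (\<lambda>z. K z t) (a z t) (b z t) z"
    and ca: "continuous_on (A \<times> T) (\<lambda>(z,t). a z t)"
    and cb: "continuous_on (A \<times> T) (\<lambda>(z,t). b z t)"
    and z: "z \<in> A" and e: "e > 0"
  obtains d where "d > 0" "ball z d \<subseteq> A"
    "\<And>(h::complex) t. norm h < d \<Longrightarrow> t \<in> T \<Longrightarrow>
       norm (K (z + h) t - K z t - (h * a z t + cnj h * b z t)) \<le> e * norm h"
proof -
  obtain X where X: "z \<in> X" "open X" "\<forall>x\<in>X \<inter> A. \<forall>t\<in>T. dist (a x t) (a z t) \<le> e/2"
    using continuous_on_prod_compactE[OF ca T z, of "e/2"] e by auto
  obtain Y where Y: "z \<in> Y" "open Y" "\<forall>x\<in>Y \<inter> A. \<forall>t\<in>T. dist (b x t) (b z t) \<le> e/2"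
    using continuous_on_prod_compactE[OF cb T z, of "e/2"] e by auto
  have "open (X \<inter> Y \<inter> A)" "z \<in> X \<inter> Y \<inter> A" using X Y A z by auto
  then obtain d where d0: "d > 0" and sub: "ball z d \<subseteq> X \<inter> Y \<inter> A"
    by (meson open_contains_ball)
  show thesis
  proof (rule that[OF d0])
    show "ball z d \<subseteq> A" using sub by auto
    fix h :: complex and t assume h: "norm h < d" and t: "t \<in> T"
    have "norm (K (z+h) t - K z t - (\<lambda>v. v * a z t + cnj v * b z t) (z + h - z)) \<le> norm (z + h - z) * e"
    proof (rule differentiable_bound_linearization[where S = "ball z d" and f = "\<lambda>z. K z t"
          and f' = "\<lambda>x v. v * a x t + cnj v * b x t"])
      fix s :: real assume "s \<in> {0..1}"
      then have "norm (s *\<^sub>R h) \<le> 1 * norm h" unfolding norm_scaleR by (intro mult_right_mono) auto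
      then have "norm (s *\<^sub>R h) < d" using h by linarith
      then show "z + s *\<^sub>R (z + h - z) \<in> ball z d" by (auto simp: dist_norm)
    next
      fix x assume "x \<in> ball z d"
      with sub d t show "((\<lambda>z. K z t) has_derivative (\<lambda>v. v * a x t + cnj v * b x t)) (at x within ball z d)"
        unfolding has_dz_def by (blast intro: has_derivative_at_withinI)
    next
      fix x assume "x \<in> ball z d"
      then have x: "x \<in> X \<inter> A" "x \<in> Y \<inter> A" using sub by auto
      have "norm (a x t - a z t) \<le> e/2" "norm (b x t - b z t) \<le> e/2"
        using X(3) Y(3) x t by (auto simp: dist_norm)
      note n = this
      show "onorm ((\<lambda>v. v * a x t + cnj v * b x t) - (\<lambda>v. v * a z t + cnj v * b z t)) \<le> e"
      proof (rule onorm_le)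
        fix v
        have "norm (v * (a x t - a z t) + cnj v * (b x t - b z t))
            \<le> norm v * (e/2) + norm v * (e/2)"
          using n by (intro norm_triangle_mono) (simp_all only: norm_mult complex_mod_cnj mult_left_mono norm_ge_zero)
        then show "norm (((\<lambda>v. v * a x t + cnj v * b x t) - (\<lambda>v. v * a z t + cnj v * b z t)) v) \<le> e * norm v"
          by (simp add: algebra_simps)
      qed
    qed (use d0 in auto)
    then show "norm (K (z + h) t - K z t - (h * a z t + cnj h * b z t)) \<le> e * norm h"
      by (simp add: mult.commute)
  qed
qed

text \<open>The derivative at \<open>z\<close> of a holomorphic function is controlled by its supremum on a disk around \<open>z\<close>, and
  on a compact disk \<open>K \<cdot> s\<close> tends to \<open>K \<cdot> t\<close> uniformly as \<open>s\<close> tends to \<open>t\<close>.\<close>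

lemma continuous_on_deriv_param:
  fixes K :: "complex \<Rightarrow> 'b::metric_space \<Rightarrow> complex"
  assumes A: "open A" and K: "continuous_on (A \<times> T) (\<lambda>(z,t). K z t)"
    and hol: "\<And>t. t \<in> T \<Longrightarrow> (\<lambda>z. K z t) holomorphic_on A"
  shows "continuous_on (A \<times> T) (\<lambda>(z,t). deriv (\<lambda>z. K z t) z)"
  unfolding continuous_on_iff
proof safe
  fix z t and e :: real assume z: "z \<in> A" and t: "t \<in> T" and e: "e > 0"
  obtain r where r: "r > 0" "cball z r \<subseteq> A" using A z by (meson open_contains_cball)
  have c: "continuous_on (T \<times> cball z r) (\<lambda>(t,z). K z t)"
    by (rule continuous_on_swap_args, rule continuous_on_subset[OF K]) (use r in auto)
  obtain X where X: "t \<in> X" "open X" "\<forall>s\<in>X \<inter> T. \<forall>x\<in>cball z r. dist (K x s) (K x t) \<le> e*r/8"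
    using continuous_on_prod_compactE[OF c compact_cball t, of "e*r/8"] e r by auto
  obtain d1 where d1: "d1 > 0" "ball t d1 \<subseteq> X" using X by (meson open_contains_ball)
  have "(\<lambda>x. deriv (\<lambda>z. K z t) x) holomorphic_on A"
    using hol[OF t] A by (rule holomorphic_deriv)
  then have "continuous_on A (deriv (\<lambda>z. K z t))" by (rule holomorphic_on_imp_continuous_on)
  then obtain d2 where d2: "d2 > 0"
      "\<And>x. x \<in> A \<Longrightarrow> dist x z < d2 \<Longrightarrow> dist (deriv (\<lambda>z. K z t) x) (deriv (\<lambda>z. K z t) z) < e/2"
    using z e unfolding continuous_on_iff by (metis half_gt_zero)
  define d where "d = min d1 (min d2 (r/2))"
  have "d > 0" using d1 d2 r by (simp add: d_def)
  moreover have "dist (deriv (\<lambda>z. K z s) x) (deriv (\<lambda>z. K z t) z) < e"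
    if x: "x \<in> A" and s: "s \<in> T" and xs: "dist (x,s) (z,t) < d" for x s
  proof -
    have dx: "dist x z < d" and ds: "dist s t < d"
      using xs dist_fst_le[of "(x,s)" "(z,t)"] dist_snd_le[of "(x,s)" "(z,t)"] by auto
    have sX: "s \<in> X \<inter> T" using ds d1 s by (auto simp: d_def dist_commute subset_iff)
    have sub: "cball x (r/2) \<subseteq> cball z r"
    proof
      fix y assume "y \<in> cball x (r/2)"
      then have "dist z y \<le> r/2 + r/2" using dx dist_triangle[of z y x] by (auto simp: d_def dist_commute)
      then show "y \<in> cball z r" by simp
    qed
    have h1: "(\<lambda>y. K y s - K y t) holomorphic_on A"
      using hol[OF t] hol[OF s] by (intro holomorphic_intros)
    have "norm ((deriv ^^ 1) (\<lambda>y. K y s - K y t) x) \<le> fact 1 * (e*r/8) / (r/2)^1"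
    proof (rule Cauchy_inequality)
      show "(\<lambda>y. K y s - K y t) holomorphic_on ball x (r/2)"
        using h1 sub r ball_subset_cball by (meson holomorphic_on_subset order_trans)
      show "continuous_on (cball x (r/2)) (\<lambda>y. K y s - K y t)"
        using h1 sub r by (meson holomorphic_on_imp_continuous_on holomorphic_on_subset order_trans)
      show "r/2 > 0" using r by simp
      fix y assume "norm (x - y) = r/2"
      then have "y \<in> cball x (r/2)" by (simp add: dist_norm)
      then show "norm (K y s - K y t) \<le> e*r/8" using sub X(3) sX by (auto simp: dist_norm)
    qed
    then have "norm (deriv (\<lambda>y. K y s - K y t) x) \<le> e/4" using r by (simp add: field_simps)
    moreover have "deriv (\<lambda>y. K y s - K y t) x = deriv (\<lambda>z. K z s) x - deriv (\<lambda>z. K z t) x"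
      using hol[OF t] hol[OF s] A x
      by (intro deriv_diff) (auto intro: holomorphic_on_imp_differentiable_at)
    ultimately have "dist (deriv (\<lambda>z. K z s) x) (deriv (\<lambda>z. K z t) x) \<le> e/4"
      by (simp add: dist_norm)
    moreover have "dist (deriv (\<lambda>z. K z t) x) (deriv (\<lambda>z. K z t) z) < e/2"
      using d2 x dx by (simp add: d_def)
    ultimately show ?thesis using dist_triangle[of "deriv (\<lambda>z. K z s) x" "deriv (\<lambda>z. K z t) z" "deriv (\<lambda>z. K z t) x"] e
      by linarith
  qed
  ultimately show "\<exists>d>0. \<forall>x'\<in>A \<times> T. dist x' (z, t) < d \<longrightarrow>
     dist (case x' of (z, t) \<Rightarrow> deriv (\<lambda>z. K z t) z) (deriv (\<lambda>z. K z t) z) < e"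
    by (metis (mono_tags, lifting) case_prod_unfold mem_Sigma_iff prod.collapse)
qed

lemma has_dz_deriv_param:
  assumes "open A" "\<And>t. t \<in> T \<Longrightarrow> (\<lambda>z. K z t) holomorphic_on A" "z \<in> A" "t \<in> T"
  shows "has_dz (\<lambda>z. K z t) (deriv (\<lambda>z. K z t) z) 0 z"
  using assms by (auto intro!: has_dz_holo holomorphic_derivI)

text \<open>Locally bounded derivatives make the functions \<open>K \<cdot> t\<close> Lipschitz in \<open>z\<close> with a constant independent
  of \<open>t\<close>, so continuity in the parameter alone is enough.\<close>

lemma continuous_on_param_of_bounded_dz:
  fixes K :: "complex \<Rightarrow> 'b::metric_space \<Rightarrow> complex"
  assumes A: "open A"
    and d: "\<And>z t. z \<in> A \<Longrightarrow> t \<in> T \<Longrightarrow> has_dz (\<lambda>z. K z t) (a z t) (b z t) z"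
    and cK: "\<And>z. z \<in> A \<Longrightarrow> continuous_on T (K z)"
    and bd: "\<And>z r. cball z r \<subseteq> A \<Longrightarrow> \<exists>M. \<forall>x\<in>cball z r. \<forall>t\<in>T. norm (a x t) \<le> M \<and> norm (b x t) \<le> M"
  shows "continuous_on (A \<times> T) (\<lambda>(z,t). K z t)"
  unfolding continuous_on_iff
proof safe
  fix z t and e :: real assume z: "z \<in> A" and t: "t \<in> T" and e: "e > 0"
  obtain r where r: "r > 0" "cball z r \<subseteq> A" using A z by (meson open_contains_cball)
  obtain M0 where M0: "\<forall>x\<in>cball z r. \<forall>t\<in>T. norm (a x t) \<le> M0 \<and> norm (b x t) \<le> M0"
    using bd[OF r(2)] by blast
  define M where "M = max M0 1"
  have M: "M > 0" "\<And>x t. x \<in> cball z r \<Longrightarrow> t \<in> T \<Longrightarrow> norm (a x t) \<le> M \<and> norm (b x t) \<le> M"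
    using M0 by (auto simp: M_def le_max_iff_disj)
  obtain d2 where d2: "d2 > 0" "\<And>s. s \<in> T \<Longrightarrow> dist s t < d2 \<Longrightarrow> dist (K z s) (K z t) < e/2"
    using cK[OF z] t e unfolding continuous_on_iff by (metis half_gt_zero)
  define d where "d = min r (min d2 (e / (4 * M)))"
  have "d > 0" using r d2 e M by (simp add: d_def)
  moreover have "dist (K x s) (K z t) < e" if x: "x \<in> A" and s: "s \<in> T" and xs: "dist (x,s) (z,t) < d" for x s
  proof -
    have dx: "dist x z < d" and ds: "dist s t < d"
      using xs dist_fst_le[of "(x,s)" "(z,t)"] dist_snd_le[of "(x,s)" "(z,t)"] by auto
    have "norm (K x s - K z s) \<le> 2 * M * norm (x - z)"
    proof (rule differentiable_bound[where S = "cball z r" and f = "\<lambda>z. K z s" and f' = "\<lambda>x v. v * a x s + cnj v * b x s"])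
      show "((\<lambda>z. K z s) has_derivative (\<lambda>v. v * a y s + cnj v * b y s)) (at y within cball z r)"
        if "y \<in> cball z r" for y
        using d[of y s] that r s unfolding has_dz_def by (blast intro: has_derivative_at_withinI)
      show "onorm (\<lambda>v. v * a y s + cnj v * b y s) \<le> 2 * M" if y: "y \<in> cball z r" for y
      proof (rule onorm_le)
        fix v
        have "norm (v * a y s + cnj v * b y s) \<le> norm v * M + norm v * M"
          using M(2)[OF y s] by (intro norm_triangle_mono) (simp_all add: norm_mult mult_left_mono)
        then show "norm (v * a y s + cnj v * b y s) \<le> 2 * M * norm v" by (simp add: algebra_simps)
      qed
    qed (use r dx in \<open>auto simp: d_def dist_commute\<close>)
    also have "\<dots> < 2 * M * (e / (4 * M))"
      using M dx by (intro mult_strict_left_mono) (auto simp: d_def dist_norm)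
    also have "\<dots> = e / 2" using M by simp
    finally have "dist (K x s) (K z s) < e / 2" by (simp add: dist_norm)
    moreover have "dist (K z s) (K z t) < e / 2" using d2 s ds by (simp add: d_def)
    ultimately show ?thesis using dist_triangle[of "K x s" "K z t" "K z s"] by linarith
  qed
  ultimately show "\<exists>d>0. \<forall>x'\<in>A \<times> T. dist x' (z, t) < d \<longrightarrow> dist (case x' of (z, t) \<Rightarrow> K z t) (K z t) < e"
    by (intro exI[of _ d]) auto
qed

section \<open>Real analytic functions and their complexification\<close>

text \<open>The complexification of a real analytic function near \<open>0\<close>: the function itself is \<open>K z (cnj z)\<close>.\<close>

definition sep_holo :: "real \<Rightarrow> (complex \<Rightarrow> complex \<Rightarrow> complex) \<Rightarrow> bool" where
  "sep_holo r K \<longleftrightarrow> continuous_on (ball 0 r \<times> ball 0 r) (\<lambda>(z,w). K z w)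
     \<and> (\<forall>w\<in>ball 0 r. (\<lambda>z. K z w) holomorphic_on ball 0 r)
     \<and> (\<forall>z\<in>ball 0 r. (\<lambda>w. K z w) holomorphic_on ball 0 r)"

lemma sep_holo_swap: "sep_holo r K \<Longrightarrow> sep_holo r (\<lambda>z w. K w z)"
  unfolding sep_holo_def by (auto intro: continuous_on_swap_args)

text \<open>Holomorphy of \<open>\<partial>\<^sub>z K\<close> in \<open>w\<close>: the difference quotients in \<open>z\<close> are holomorphic in \<open>w\<close> and converge
  locally uniformly in \<open>w\<close>. So the class is closed under \<open>\<partial>\<^sub>z\<close>, and can be differentiated
  indefinitely.\<close>

lemma sep_holo_deriv:
  assumes K: "sep_holo r K"
  shows "sep_holo r (\<lambda>z w. deriv (\<lambda>z. K z w) z)"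
  unfolding sep_holo_def
proof (intro conjI ballI)
  have cK: "continuous_on (ball 0 r \<times> ball 0 r) (\<lambda>(z,w). K z w)"
    and h1: "\<And>w. w \<in> ball 0 r \<Longrightarrow> (\<lambda>z. K z w) holomorphic_on ball 0 r"
    and h2: "\<And>z. z \<in> ball 0 r \<Longrightarrow> (\<lambda>w. K z w) holomorphic_on ball 0 r"
    using K by (auto simp: sep_holo_def)
  show cd: "continuous_on (ball 0 r \<times> ball 0 r) (\<lambda>(z, w). deriv (\<lambda>z. K z w) z)"
    by (rule continuous_on_deriv_param[OF open_ball cK h1])
  show "(\<lambda>z. deriv (\<lambda>z. K z w) z) holomorphic_on ball 0 r" if "w \<in> ball 0 r" for w
    using h1[OF that] by (rule holomorphic_deriv) simp
  fix z :: complex assume z: "z \<in> ball 0 r"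
  obtain s where s: "s > 0" "ball z s \<subseteq> ball 0 r" using z by (meson open_ball open_contains_ball)
  \<comment> \<open>Steps that stay inside the disk around \<open>z\<close> for all indices and tend to zero.\<close>
  define \<tau> where "\<tau> n = complex_of_real (s / real (n+2))" for n
  have \<tau>n: "norm (\<tau> n) = s / real (n+2)" for n
    using s unfolding \<tau>_def norm_of_real by (subst abs_of_pos) auto
  then have \<tau>0: "\<tau> n \<noteq> 0" for n using s by (metis add_2_eq_Suc' divide_pos_pos norm_zero of_nat_0_less_iff order_less_irrefl zero_less_Suc)
  have \<tau>lt: "norm (\<tau> n) < s" for n unfolding \<tau>n using s by (simp add: divide_less_eq distrib_left add_pos_nonneg)
  have \<tau>lim: "(\<lambda>n. norm (\<tau> n)) \<longlonglongrightarrow> 0"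
  proof -
    have "(\<lambda>n. s * inverse (real (n+2))) \<longlonglongrightarrow> s * 0"
      by (intro tendsto_intros LIMSEQ_ignore_initial_segment[OF lim_inverse_n])
    then show ?thesis by (simp add: \<tau>n divide_inverse)
  qed
  show "(\<lambda>w. deriv (\<lambda>z. K z w) z) holomorphic_on ball 0 r"
  proof (rule holomorphic_uniform_sequence[where f = "\<lambda>n w. (K (z + \<tau> n) w - K z w) / \<tau> n"])
    fix n
    have "z + \<tau> n \<in> ball z s" using \<tau>lt by (simp add: dist_norm)
    then have "z + \<tau> n \<in> ball 0 r" using s by blast
    then show "(\<lambda>w. (K (z + \<tau> n) w - K z w) / \<tau> n) holomorphic_on ball 0 r"
      using h2 z \<tau>0 by (intro holomorphic_intros) auto
  next
    fix w :: complex assume w: "w \<in> ball 0 r"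
    obtain \<rho> where \<rho>: "\<rho> > 0" "cball w \<rho> \<subseteq> ball 0 r" using w by (meson open_ball open_contains_cball)
    have "uniform_limit (cball w \<rho>) (\<lambda>n w. (K (z + \<tau> n) w - K z w) / \<tau> n) (\<lambda>w. deriv (\<lambda>z. K z w) z) sequentially"
    proof (rule uniform_limitI)
      fix e :: real assume e: "e > 0"
      obtain d where d: "d > 0" and dd: "\<And>h t. norm h < d \<Longrightarrow> t \<in> cball w \<rho> \<Longrightarrow>
         norm (K (z + h) t - K z t - (h * deriv (\<lambda>z. K z t) z + cnj h * 0)) \<le> e/2 * norm h"
      proof (rule uniform_dz[where A = "ball 0 r" and T = "cball w \<rho>" and K = K
            and a = "\<lambda>z t. deriv (\<lambda>z. K z t) z" and b = "\<lambda>_ _. 0" and z = z and e = "e/2"])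
        show "has_dz (\<lambda>z. K z t) (deriv (\<lambda>z. K z t) z) 0 z"
          if "z \<in> ball 0 r" "t \<in> cball w \<rho>" for z t
          using that h1 \<rho> by (intro has_dz_deriv_param[where T = "ball 0 r" and A = "ball 0 r"]) auto
        show "continuous_on (ball 0 r \<times> cball w \<rho>) (\<lambda>(z, t). deriv (\<lambda>z. K z t) z)"
          by (rule continuous_on_subset[OF cd]) (use \<rho> in auto)
      qed (use z e in auto)
      have "\<forall>\<^sub>F n in sequentially. norm (\<tau> n) < d" using \<tau>lim d by (rule order_tendstoD)
      then show "\<forall>\<^sub>F n in sequentially. \<forall>x\<in>cball w \<rho>.
          dist ((K (z + \<tau> n) x - K z x) / \<tau> n) (deriv (\<lambda>z. K z x) z) < e"
      proof (rule eventually_mono, intro ballI)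
        fix n x assume n: "norm (\<tau> n) < d" and x: "x \<in> cball w \<rho>"
        have "(K (z + \<tau> n) x - K z x) / \<tau> n - deriv (\<lambda>z. K z x) z
            = (K (z + \<tau> n) x - K z x - (\<tau> n * deriv (\<lambda>z. K z x) z + cnj (\<tau> n) * 0)) / \<tau> n"
          using \<tau>0[of n] by (simp add: field_simps)
        then have "dist ((K (z + \<tau> n) x - K z x) / \<tau> n) (deriv (\<lambda>z. K z x) z)
            = norm (K (z + \<tau> n) x - K z x - (\<tau> n * deriv (\<lambda>z. K z x) z + cnj (\<tau> n) * 0)) / norm (\<tau> n)"
          by (simp add: dist_norm norm_divide)
        also have "\<dots> \<le> (e/2 * norm (\<tau> n)) / norm (\<tau> n)"
          by (intro divide_right_mono dd n x) simp
        also have "\<dots> < e" using e \<tau>0[of n] by simp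
        finally show "dist ((K (z + \<tau> n) x - K z x) / \<tau> n) (deriv (\<lambda>z. K z x) z) < e" .
      qed
    qed
    then show "\<exists>d>0. cball w d \<subseteq> ball 0 r \<and> uniform_limit (cball w d)
       (\<lambda>n w. (K (z + \<tau> n) w - K z w) / \<tau> n) (\<lambda>w. deriv (\<lambda>z. K z w) z) sequentially"
      using \<rho> by blast
  qed simp
qed

text \<open>\<open>\<partial>\<^sub>z\<close> of the real analytic function differentiates the first variable of its complexification, and
  \<open>\<partial>\<close> with respect to \<open>\<bar>z\<close> the second; so \<open>\<bar>z\<close> behaves as an independent variable.\<close>

lemma has_dz_sep_holo:
  assumes K: "sep_holo r K" and z: "z \<in> ball 0 r"
  shows "has_dz (\<lambda>z. K z (cnj z)) (deriv (\<lambda>\<zeta>. K \<zeta> (cnj z)) z) (deriv (\<lambda>w. K z w) (cnj z)) z"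
proof -
  let ?B = "ball 0 r :: complex set"
  have cK: "continuous_on (?B \<times> ?B) (\<lambda>(z,w). K z w)"
    and h1: "\<And>w. w \<in> ?B \<Longrightarrow> (\<lambda>z. K z w) holomorphic_on ?B"
    and h2: "\<And>z. z \<in> ?B \<Longrightarrow> (\<lambda>w. K z w) holomorphic_on ?B"
    using K by (auto simp: sep_holo_def)
  have zc: "cnj z \<in> ?B" using z by (simp add: dist_norm)
  let ?D = "\<lambda>z w. deriv (\<lambda>w. K z w) w"
  have "continuous_on (?B \<times> ?B) (\<lambda>(z,w). ?D z w)"
    using sep_holo_swap[OF sep_holo_deriv[OF sep_holo_swap[OF K]]] by (auto simp: sep_holo_def)
  then have "continuous_on (?B \<times> ?B) (\<lambda>(z,w). blinfun_mult_right (?D z w))"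
    using bounded_linear.continuous_on[OF bounded_linear_blinfun_mult_right, of "?B \<times> ?B" "\<lambda>(z,w). ?D z w"]
    by (simp add: case_prod_unfold)
  then have c: "continuous (at (z, cnj z) within ?B \<times> ?B) (\<lambda>(z,w). blinfun_mult_right (?D z w))"
    using z zc by (simp add: continuous_on_eq_continuous_within)
  have "((\<lambda>(x, y). K x y) has_derivative
      (\<lambda>(tx, ty). tx * deriv (\<lambda>\<zeta>. K \<zeta> (cnj z)) z + blinfun_apply (blinfun_mult_right (?D z (cnj z))) ty))
      (at (z, cnj z) within ?B \<times> ?B)"
  proof (rule has_derivative_partialsI[where fx = "\<lambda>tx. tx * deriv (\<lambda>\<zeta>. K \<zeta> (cnj z)) z"])
    show "((\<lambda>x. K x (cnj z)) has_derivative (\<lambda>tx. tx * deriv (\<lambda>\<zeta>. K \<zeta> (cnj z)) z)) (at z within ?B)"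
      using has_dz_deriv_param[of ?B ?B K, OF open_ball h1 z zc, unfolded has_dz_def]
      by (simp add: has_derivative_at_withinI)
    show "((\<lambda>y. K x y) has_derivative blinfun_apply (blinfun_mult_right (?D x y))) (at y within ?B)"
      if "x \<in> ?B" "y \<in> ?B" for x y
    proof -
      have "((\<lambda>y. K x y) has_field_derivative ?D x y) (at y)"
        using that h2 by (intro holomorphic_derivI[of _ ?B]) auto
      then show ?thesis by (auto simp: has_field_derivative_def blinfun_mult_right.rep_eq intro: has_derivative_at_withinI)
    qed
  qed (use c zc in auto)
  then have *: "((\<lambda>(x, y). K x y) has_derivative
      (\<lambda>(tx, ty). tx * deriv (\<lambda>\<zeta>. K \<zeta> (cnj z)) z + ?D z (cnj z) * ty)) (at (z, cnj z))"
    using z zc by (simp add: at_within_open[OF _ open_Times[OF open_ball open_ball]] blinfun_mult_right.rep_eq)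
  have **: "((\<lambda>x. (x, cnj x)) has_derivative (\<lambda>v. (v, cnj v))) (at z)"
    by (auto intro!: derivative_eq_intros)
  show ?thesis
    using has_derivative_compose[OF ** *] by (simp add: has_dz_def mult.commute)
qed

lemma sep_holo_fst: "f holomorphic_on ball 0 r \<Longrightarrow> sep_holo r (\<lambda>z w. f z)"
  unfolding sep_holo_def case_prod_unfold
  by (auto intro!: continuous_on_compose2[OF holomorphic_on_imp_continuous_on, of f "ball 0 r"] continuous_intros)

lemma sep_holo_mult: "sep_holo r K \<Longrightarrow> sep_holo r L \<Longrightarrow> sep_holo r (\<lambda>z w. K z w * L z w)"
  unfolding sep_holo_def case_prod_unfold
  by (auto intro!: continuous_intros holomorphic_intros)

lemma sep_holo_diff: "sep_holo r K \<Longrightarrow> sep_holo r L \<Longrightarrow> sep_holo r (\<lambda>z w. K z w - L z w)"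
  unfolding sep_holo_def case_prod_unfold
  by (auto intro!: continuous_intros holomorphic_intros)

lemma sep_holo_exp: "sep_holo r K \<Longrightarrow> sep_holo r (\<lambda>z w. exp (c * K z w))"
  unfolding sep_holo_def case_prod_unfold
  by (auto intro!: continuous_intros holomorphic_intros)

lemma sep_holo_subset: "sep_holo r K \<Longrightarrow> s \<le> r \<Longrightarrow> sep_holo s K"
  unfolding sep_holo_def
  by (auto intro: holomorphic_on_subset[where s = "ball 0 r"] continuous_on_subset[where s = "ball 0 r \<times> ball 0 r"])

section \<open>Functions with vanishing holomorphic jet\<close>

text \<open>The derivatives \<open>\<partial>\<^sub>z\<^sup>k \<phi>\<close> exist on \<open>W\<close> and vanish at \<open>0\<close> for all \<open>k \<le> n\<close>. The derivatives with respect
  to \<open>\<bar>z\<close> are unrestricted at \<open>0\<close>.\<close>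

fun zflat :: "complex set \<Rightarrow> nat \<Rightarrow> (complex \<Rightarrow> complex) \<Rightarrow> bool" where
  "zflat W 0 \<phi> \<longleftrightarrow> \<phi> 0 = 0"
| "zflat W (Suc n) \<phi> \<longleftrightarrow> \<phi> 0 = 0 \<and> (\<exists>a b. (\<forall>z\<in>W. has_dz \<phi> (a z) (b z) z) \<and> zflat W n a)"

lemma zflat_SucI:
  "\<phi> 0 = 0 \<Longrightarrow> (\<And>z. z \<in> W \<Longrightarrow> has_dz \<phi> (a z) (b z) z) \<Longrightarrow> zflat W n a \<Longrightarrow> zflat W (Suc n) \<phi>"
  by (subst zflat.simps(2)) blast

lemma zflat_SucD: "zflat W (Suc n) \<phi> \<Longrightarrow> zflat W n \<phi>"
  by (induction n arbitrary: \<phi>) auto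

lemma zflat_cong:
  assumes "zflat W n \<phi>" "open W" "0 \<in> W" "\<And>z. z \<in> W \<Longrightarrow> \<phi> z = \<psi> z"
  shows "zflat W n \<psi>"
proof (cases n)
  case (Suc m)
  with assms(1) obtain a b where "\<phi> 0 = 0" "\<forall>z\<in>W. has_dz \<phi> (a z) (b z) z" "zflat W m a" by auto
  then show ?thesis unfolding Suc using assms(2-4) has_dz_cong[of \<phi> _ _ _ W \<psi>]
    by (intro zflat_SucI[of _ _ a b]) auto
qed (use assms in auto)

lemma zflat_add: "zflat W n \<phi> \<Longrightarrow> zflat W n \<psi> \<Longrightarrow> zflat W n (\<lambda>z. \<phi> z + \<psi> z)"
proof (induction n arbitrary: \<phi> \<psi>)
  case (Suc n)
  from Suc.prems obtain a b a' b' where *: "\<phi> 0 = 0" "\<psi> 0 = 0" "\<forall>z\<in>W. has_dz \<phi> (a z) (b z) z" "zflat W n a"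
    "\<forall>z\<in>W. has_dz \<psi> (a' z) (b' z) z" "zflat W n a'" by auto
  show ?case
    by (rule zflat_SucI[of _ _ "\<lambda>z. a z + a' z" "\<lambda>z. b z + b' z"])
      (use * Suc.IH in \<open>auto intro: has_dz_add\<close>)
qed simp

text \<open>Leibniz rule. One factor is real analytic, so that it can be differentiated indefinitely; of the
  other one only \<open>\<partial>\<^sub>z\<close>-derivatives up to order \<open>n\<close> are known to exist.\<close>

lemma zflat_mult_diag:
  "sep_holo r K \<Longrightarrow> zflat (ball 0 r) n \<phi> \<Longrightarrow> zflat (ball 0 r) n (\<lambda>z. K z (cnj z) * \<phi> z)"
proof (induction n arbitrary: \<phi> K)
  case (Suc n)
  from Suc.prems obtain a b where *: "\<phi> 0 = 0" "\<forall>z\<in>ball 0 r. has_dz \<phi> (a z) (b z) z" "zflat (ball 0 r) n a" by auto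
  let ?a = "\<lambda>z. deriv (\<lambda>\<zeta>. K \<zeta> (cnj z)) z * \<phi> z + K z (cnj z) * a z"
  let ?b = "\<lambda>z. deriv (\<lambda>w. K z w) (cnj z) * \<phi> z + K z (cnj z) * b z"
  have "has_dz (\<lambda>z. K z (cnj z) * \<phi> z) (?a z) (?b z) z" if "z \<in> ball 0 r" for z
    using has_dz_mult[OF has_dz_sep_holo[OF Suc.prems(1) that]] * that by blast
  moreover have "zflat (ball 0 r) n ?a"
    by (intro zflat_add Suc.IH(1)[OF Suc.prems(1) *(3)]
        Suc.IH(1)[OF sep_holo_deriv[OF Suc.prems(1)] zflat_SucD[OF Suc.prems(2)]])
  ultimately show ?case using *(1) by (intro zflat_SucI[of _ _ ?a ?b]) auto
qed simp

lemma zflat_cmult: "zflat (ball 0 r) n \<phi> \<Longrightarrow> zflat (ball 0 r) n (\<lambda>z. c * \<phi> z)"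
  by (rule zflat_mult_diag[of r "\<lambda>_ _. c"]) (rule sep_holo_fst, auto)

lemma zflat_diff: "zflat (ball 0 r) n \<phi> \<Longrightarrow> zflat (ball 0 r) n \<psi> \<Longrightarrow> zflat (ball 0 r) n (\<lambda>z. \<phi> z - \<psi> z)"
  using zflat_add[of "ball 0 r" n \<phi> "\<lambda>z. (-1) * \<psi> z"] zflat_cmult[of r n \<psi> "-1"] by simp

text \<open>The \<open>\<partial>\<^sub>z\<close>-jet of a real analytic function at \<open>0\<close> only depends on its holomorphic part.\<close>

lemma zflat_diag:
  "sep_holo r K \<Longrightarrow> 0 < r \<Longrightarrow> (\<And>z. z \<in> ball 0 r \<Longrightarrow> K z 0 = 0) \<Longrightarrow> zflat (ball 0 r) n (\<lambda>z. K z (cnj z))"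
proof (induction n arbitrary: K)
  case (Suc n)
  have "deriv (\<lambda>\<zeta>. K \<zeta> 0) z = 0" if "z \<in> ball 0 r" for z
  proof -
    have "deriv (\<lambda>\<zeta>. K \<zeta> 0) z = deriv (\<lambda>_. 0) z"
      by (rule deriv_cong_ev) (use that Suc.prems in \<open>auto intro: eventually_nhds_in_open[THEN eventually_mono, of "ball 0 r"]\<close>)
    then show ?thesis by simp
  qed
  then have "zflat (ball 0 r) n (\<lambda>z. deriv (\<lambda>\<zeta>. K \<zeta> (cnj z)) z)"
    using Suc.IH[OF sep_holo_deriv[OF Suc.prems(1)]] Suc.prems by blast
  moreover have "\<forall>z\<in>ball 0 r. has_dz (\<lambda>z. K z (cnj z)) (deriv (\<lambda>\<zeta>. K \<zeta> (cnj z)) z) (deriv (\<lambda>w. K z w) (cnj z)) z"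
    using has_dz_sep_holo[OF Suc.prems(1)] by blast
  ultimately show ?case using Suc.prems
    by (intro zflat_SucI[of _ _ "\<lambda>z. deriv (\<lambda>\<zeta>. K \<zeta> (cnj z)) z" "\<lambda>z. deriv (\<lambda>w. K z w) (cnj z)"]) auto
qed auto

lemma zflat_imp_higher_deriv_0:
  assumes "zflat W n f" "f holomorphic_on W" "open W" "0 \<in> W"
  shows "(deriv ^^ n) f 0 = 0"
  using assms(1,2)
proof (induction n arbitrary: f)
  case (Suc n)
  from Suc.prems obtain a b where *: "\<forall>z\<in>W. has_dz f (a z) (b z) z" "zflat W n a" by auto
  have "has_dz f (deriv f z) 0 z" if "z \<in> W" for z
    using that Suc.prems assms by (intro has_dz_holo holomorphic_derivI[of f W]) auto
  then have "a z = deriv f z" if "z \<in> W" for z using * that has_dz_unique by blast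
  then have "zflat W n (deriv f)" using * assms by (auto intro: zflat_cong)
  then have "(deriv ^^ n) (deriv f) 0 = 0"
    using Suc.prems assms by (intro Suc.IH holomorphic_deriv) auto
  then show ?case by (simp add: funpow_Suc_right del: funpow.simps)
qed simp

section \<open>Loops that extend to the disk\<close>

definition disk_loop :: "(complex \<Rightarrow> complex) \<Rightarrow> bool" where
  "disk_loop \<phi> \<longleftrightarrow> (\<exists>G. continuous_on (cball 0 1) G \<and> G holomorphic_on ball 0 1
      \<and> (\<forall>t\<in>sphere 0 1. G t = \<phi> t))"

lemma disk_loopI:
  "continuous_on (cball 0 1) G \<Longrightarrow> G holomorphic_on ball 0 1 \<Longrightarrow> (\<And>t. t \<in> sphere 0 1 \<Longrightarrow> G t = \<phi> t)
    \<Longrightarrow> disk_loop \<phi>"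
  unfolding disk_loop_def by blast

lemma disk_loop_cong:
  "disk_loop \<phi> \<Longrightarrow> (\<And>t. t \<in> sphere 0 1 \<Longrightarrow> \<phi> t = \<psi> t) \<Longrightarrow> disk_loop \<psi>"
  unfolding disk_loop_def by metis

lemma disk_loop_const: "disk_loop (\<lambda>t. c)"
  by (rule disk_loopI[of "\<lambda>_. c"]) auto

lemma disk_loop_ident: "disk_loop (\<lambda>t. t)"
  by (rule disk_loopI[of "\<lambda>t. t"]) auto

lemma disk_loop_add:
  assumes "disk_loop \<phi>" "disk_loop \<psi>" shows "disk_loop (\<lambda>t. \<phi> t + \<psi> t)"
proof -
  obtain G M where "continuous_on (cball 0 1) G" "G holomorphic_on ball 0 1" "\<forall>t\<in>sphere 0 1. G t = \<phi> t"
     "continuous_on (cball 0 1) M" "M holomorphic_on ball 0 1" "\<forall>t\<in>sphere 0 1. M t = \<psi> t"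
    using assms unfolding disk_loop_def by blast
  then show ?thesis
    by (intro disk_loopI[of "\<lambda>t. G t + M t"] continuous_intros holomorphic_intros) auto
qed

lemma disk_loop_mult:
  assumes "disk_loop \<phi>" "disk_loop \<psi>" shows "disk_loop (\<lambda>t. \<phi> t * \<psi> t)"
proof -
  obtain G M where "continuous_on (cball 0 1) G" "G holomorphic_on ball 0 1" "\<forall>t\<in>sphere 0 1. G t = \<phi> t"
     "continuous_on (cball 0 1) M" "M holomorphic_on ball 0 1" "\<forall>t\<in>sphere 0 1. M t = \<psi> t"
    using assms unfolding disk_loop_def by blast
  then show ?thesis
    by (intro disk_loopI[of "\<lambda>t. G t * M t"] continuous_intros holomorphic_intros) auto
qed

lemma disk_loop_uminus: "disk_loop \<phi> \<Longrightarrow> disk_loop (\<lambda>t. - \<phi> t)"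
  using disk_loop_mult[OF disk_loop_const[of "-1"]] by simp

lemma disk_loop_diff: "disk_loop \<phi> \<Longrightarrow> disk_loop \<psi> \<Longrightarrow> disk_loop (\<lambda>t. \<phi> t - \<psi> t)"
  using disk_loop_add[OF _ disk_loop_uminus] by simp

lemmas disk_loop_intros = disk_loop_const disk_loop_ident disk_loop_add disk_loop_mult
  disk_loop_uminus disk_loop_diff

lemma disk_loop_divide_ident:
  assumes "continuous_on (cball 0 1) G" "G holomorphic_on ball 0 1" "G 0 = 0"
  shows "disk_loop (\<lambda>t. G t / t)"
proof (rule disk_loopI)
  let ?M = "\<lambda>z. if z = 0 then deriv G 0 else (G z - G 0) / (z - 0)"
  show h: "?M holomorphic_on ball 0 1" using assms(2) by (rule pole_lemma) auto
  have c1: "continuous_on (ball 0 1) ?M" using h by (rule holomorphic_on_imp_continuous_on)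
  have "continuous_on (cball 0 1 - {0}) (\<lambda>z. (G z - G 0) / (z - 0))"
    by (intro continuous_intros continuous_on_subset[OF assms(1)]) auto
  then have c2: "continuous_on (cball 0 1 - {0}) ?M" by (rule continuous_on_eq) auto
  have e: "ball 0 1 \<union> (cball 0 1 - {0}) = (cball 0 1 :: complex set)" by auto
  have "openin (top_of_set (cball 0 1)) (ball 0 1 :: complex set)"
    by (simp add: open_openin_trans open_subset)
  moreover have "openin (top_of_set (cball 0 1)) (cball 0 1 - {0} :: complex set)"
    by (auto simp: openin_open intro!: exI[of _ "- {0}"])
  ultimately show "continuous_on (cball 0 1) ?M"
    using continuous_on_Un_local_open[OF _ _ c1 c2, unfolded e] by blast
  fix t :: complex assume "t \<in> sphere 0 1"
  then show "?M t = G t / t" using assms(3) by auto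
qed

lemma max_modulus_disk:
  assumes "continuous_on (cball 0 1) G" "G holomorphic_on ball 0 1"
    "\<And>t. t \<in> sphere 0 1 \<Longrightarrow> norm (G t) \<le> B" "z \<in> cball 0 1"
  shows "norm (G z) \<le> B"
  by (rule maximum_modulus_frontier[of G "cball 0 1"]) (use assms in \<open>simp_all add: frontier_cball\<close>)

text \<open>By the maximum principle, uniform convergence on the circle forces uniform convergence of the extensions
  on the closed disk.\<close>

lemma disk_loop_uniform_limit:
  assumes "\<And>e. e > 0 \<Longrightarrow> \<exists>\<psi>. disk_loop \<psi> \<and> (\<forall>t\<in>sphere 0 1. norm (\<psi> t - \<phi> t) \<le> e)"
  shows "disk_loop \<phi>"
proof -
  have "\<exists>G. continuous_on (cball 0 1) G \<and> G holomorphic_on ball 0 1 \<and>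
      (\<forall>t\<in>sphere 0 1. norm (G t - \<phi> t) \<le> inverse (real (Suc n)))" for n
    using assms[of "inverse (real (Suc n))"] unfolding disk_loop_def by (metis inverse_positive_iff_positive of_nat_0_less_iff zero_less_Suc)
  then obtain G where G: "\<And>n. continuous_on (cball 0 1) (G n)" "\<And>n. G n holomorphic_on ball 0 1"
     "\<And>n t. t \<in> sphere 0 1 \<Longrightarrow> norm (G n t - \<phi> t) \<le> inverse (real (Suc n))" by metis
  have "uniformly_Cauchy_on (cball 0 1) G"
    unfolding uniformly_Cauchy_on_def
  proof (intro allI impI)
    fix e :: real assume e: "e > 0"
    obtain N where N: "inverse (real (Suc N)) < e/2" using e reals_Archimedean[of "e/2"] by auto
    have "dist (G m z) (G n z) < e" if z: "z \<in> cball 0 1" and mn: "m \<ge> N" "n \<ge> N" for z m n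
    proof -
      have i: "inverse (real (Suc k)) \<le> inverse (real (Suc N))" if "k \<ge> N" for k
        using that by (intro le_imp_inverse_le) auto
      have "norm (G m z - G n z) \<le> 2 * inverse (real (Suc N))"
      proof (rule max_modulus_disk[OF _ _ _ z])
        fix t :: complex assume t: "t \<in> sphere 0 1"
        have "norm (G m t - \<phi> t) \<le> inverse (real (Suc N))" "norm (G n t - \<phi> t) \<le> inverse (real (Suc N))"
          using G(3)[OF t] i mn by (meson order_trans)+
        then show "norm (G m t - G n t) \<le> 2 * inverse (real (Suc N))"
          using norm_triangle_ineq4[of "G m t - \<phi> t" "G n t - \<phi> t"] by simp
      qed (intro continuous_intros holomorphic_intros G)+
      with N show ?thesis by (simp add: dist_norm)
    qed
    then show "\<exists>M. \<forall>x\<in>cball 0 1. \<forall>m\<ge>M. \<forall>n\<ge>M. dist (G m x) (G n x) < e" by blast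
  qed
  then obtain L where L: "uniform_limit (cball 0 1) G L sequentially"
    using Cauchy_uniformly_convergent unfolding uniformly_convergent_on_def by blast
  show ?thesis
  proof (rule disk_loopI)
    show "continuous_on (cball 0 1) L"
      using L by (rule uniform_limit_theorem[rotated]) (simp_all add: G(1))
    show "L holomorphic_on ball 0 1"
    proof (rule holomorphic_uniform_sequence[where f = G])
      fix x :: complex assume "x \<in> ball 0 1"
      then obtain d where d: "d > 0" "cball x d \<subseteq> ball 0 1" by (meson open_ball open_contains_cball)
      then have "cball x d \<subseteq> cball 0 1" by auto
      with L d show "\<exists>d>0. cball x d \<subseteq> ball 0 1 \<and> uniform_limit (cball x d) G L sequentially"
        using uniform_limit_on_subset by blast
    qed (auto intro: G)
    fix t :: complex assume t: "t \<in> sphere 0 1"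
    then have "(\<lambda>n. G n t) \<longlonglongrightarrow> L t" using L by (intro tendsto_uniform_limitI[OF L]) auto
    moreover have "(\<lambda>n. G n t) \<longlonglongrightarrow> \<phi> t"
    proof (rule LIM_zero_cancel, rule Lim_null_comparison)
      show "\<forall>\<^sub>F n in sequentially. norm (G n t - \<phi> t) \<le> inverse (real (Suc n))" using G(3)[OF t] by simp
      show "(\<lambda>n. inverse (real (Suc n))) \<longlonglongrightarrow> 0" by (rule LIMSEQ_inverse_real_of_nat)
    qed
    ultimately show "L t = \<phi> t" by (rule LIMSEQ_unique)
  qed
qed

text \<open>The functions \<open>exp (\<plusminus>\<i> X)\<close> have modulus 1 on the circle, hence modulus at most 1 inside, so \<open>X\<close> is
  real throughout; a real holomorphic function is constant by the open mapping theorem.\<close>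

lemma holomorphic_real_boundary_const:
  assumes c: "continuous_on (cball 0 1) X" and h: "X holomorphic_on ball 0 1"
    and r: "\<And>t. t \<in> sphere 0 1 \<Longrightarrow> Im (X t) = 0" and z: "z \<in> cball 0 1"
  shows "X z = X 0"
proof -
  have Im0: "Im (X w) = 0" if w: "w \<in> cball 0 1" for w
  proof -
    have "norm (exp (\<i> * X w)) \<le> 1"
      by (rule max_modulus_disk[where G = "\<lambda>w. exp (\<i> * X w)", OF _ _ _ w])
        (use r in \<open>auto intro!: continuous_intros holomorphic_intros c h\<close>)
    moreover have "norm (exp (- (\<i> * X w))) \<le> 1"
      by (rule max_modulus_disk[where G = "\<lambda>w. exp (- (\<i> * X w))", OF _ _ _ w])
        (use r in \<open>auto intro!: continuous_intros holomorphic_intros c h\<close>)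
    ultimately
    show ?thesis by simp
  qed
  have "X constant_on ball 0 1"
  proof (rule ccontr)
    assume n: "\<not> X constant_on ball 0 1"
    have "open (X ` ball 0 1)"
      by (rule open_mapping_thm[OF h _ _ _ _ n]) auto
    then obtain e where e: "e > 0" "ball (X 0) e \<subseteq> X ` ball 0 1"
      by (metis centre_in_ball imageI open_contains_ball zero_less_one)
    have "X 0 + \<i> * (e/2) \<in> ball (X 0) e" using e by (simp add: dist_norm norm_mult)
    then have "X 0 + \<i> * (e/2) \<in> X ` ball 0 1" using e(2) by (rule subsetD[rotated])
    then obtain w where w: "w \<in> ball 0 1" "X w = X 0 + \<i> * (e/2)" by (rule imageE) simp
    then have "Im (X w) = e/2" using Im0[of 0] by simp
    then show False using Im0[of w] w e by auto
  qed
  then have "X w = X 0" if "w \<in> ball 0 1" for w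
    using that unfolding constant_on_def by (metis centre_in_ball zero_less_one)
  note inner = this
  show ?thesis
  proof (rule continuous_constant_on_closure[of "ball 0 1" X "X 0" z])
    show "X w = X 0" if "w \<in> ball 0 1" for w using that by (rule inner)
  qed (use c z in simp_all)
qed

text \<open>A form of Liouville's theorem: a loop that extends holomorphically both to the disk and to its exterior,
  infinity included, is constant; the exterior is described by the inversion \<open>t \<mapsto> cnj t\<close> of the circle.
  The function \<open>N w = cnj (M (cnj w))\<close> has the boundary values \<open>cnj (G t)\<close>, so \<open>G + N\<close> and
  \<open>\<i> (G - N)\<close> are real on the circle.\<close>

lemma disk_loop_reflect_const:
  assumes G: "continuous_on (cball 0 1) G" "G holomorphic_on ball 0 1"
    and M: "continuous_on (cball 0 1) M" "M holomorphic_on ball 0 1"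
    and e: "\<And>t. t \<in> sphere 0 1 \<Longrightarrow> G t = M (cnj t)"
    and z: "z \<in> cball 0 1"
  shows "G z = G 0"
proof -
  define N where "N = cnj \<circ> M \<circ> cnj"
  have im: "cnj ` ball 0 1 = ball 0 1" "cnj ` cball 0 1 = cball 0 1"
    by (auto simp: image_iff dist_norm intro!: bexI[of _ "cnj _"])
  have N: "continuous_on (cball 0 1) N" "N holomorphic_on ball 0 1"
    unfolding N_def comp_def
    using holomorphic_on_compose_cnj_cnj[of M "ball 0 1"] M im
    by (auto simp: comp_def intro!: continuous_intros continuous_on_compose2[OF M(1)])
  have Nt: "N t = cnj (G t)" if "t \<in> sphere 0 1" for t
    using e that by (simp add: N_def)
  have 1: "G z + N z = G 0 + N 0"
    using N G Nt z by (intro holomorphic_real_boundary_const[where X = "\<lambda>z. G z + N z"] continuous_intros holomorphic_intros) auto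
  have 2: "\<i> * (G z - N z) = \<i> * (G 0 - N 0)"
    using N G Nt z by (intro holomorphic_real_boundary_const[where X = "\<lambda>z. \<i> * (G z - N z)"] continuous_intros holomorphic_intros) auto
  from 2 have "G z - N z = G 0 - N 0" by simp
  then have "(G z + N z) + (G z - N z) = (G 0 + N 0) + (G 0 - N 0)" using 1 by (simp only:)
  then have "2 * G z = 2 * G 0" by simp
  then show ?thesis by simp
qed

text \<open>The Fourier coefficient of \<open>t\<^bsup>k - 1\<^esup>\<close>. The shift by one brings the index \<open>-1\<close>, the lowest one that
  occurs, into the natural numbers: \<open>k = 0\<close> is the coefficient that vanishes for loops extending to
  the disk, and \<open>k = 1\<close> is the value of the extension at the origin.\<close>

definition loop_coeff :: "nat \<Rightarrow> (complex \<Rightarrow> complex) \<Rightarrow> complex" where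
  "loop_coeff k \<phi> = contour_integral (circlepath 0 1) (\<lambda>t. \<phi> t / t ^ k) / (2 * pi * \<i>)"

lemma loop_coeff_integrable:
  assumes "continuous_on (sphere 0 1) \<phi>"
  shows "(\<lambda>t. \<phi> t / t ^ k) contour_integrable_on circlepath 0 1"
  by (intro contour_integrable_continuous_circlepath continuous_intros) (use assms in auto)

lemma loop_coeff_cong:
  "(\<And>t. t \<in> sphere 0 1 \<Longrightarrow> \<phi> t = \<psi> t) \<Longrightarrow> loop_coeff k \<phi> = loop_coeff k \<psi>"
  unfolding loop_coeff_def by (subst contour_integral_cong) auto

lemma loop_coeff_add:
  assumes "continuous_on (sphere 0 1) \<phi>" "continuous_on (sphere 0 1) \<psi>"
  shows "loop_coeff k (\<lambda>t. \<phi> t + \<psi> t) = loop_coeff k \<phi> + loop_coeff k \<psi>"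
  using contour_integral_add[OF loop_coeff_integrable[OF assms(1)] loop_coeff_integrable[OF assms(2)]]
  by (simp add: loop_coeff_def add_divide_distrib)

lemma loop_coeff_diff:
  assumes "continuous_on (sphere 0 1) \<phi>" "continuous_on (sphere 0 1) \<psi>"
  shows "loop_coeff k (\<lambda>t. \<phi> t - \<psi> t) = loop_coeff k \<phi> - loop_coeff k \<psi>"
  using contour_integral_diff[OF loop_coeff_integrable[OF assms(1)] loop_coeff_integrable[OF assms(2)]]
  by (simp add: loop_coeff_def diff_divide_distrib)

lemma loop_coeff_cmult:
  assumes "continuous_on (sphere 0 1) \<phi>"
  shows "loop_coeff k (\<lambda>t. c * \<phi> t) = c * loop_coeff k \<phi>"
  using contour_integral_lmul[OF loop_coeff_integrable[OF assms], of c]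
  by (simp add: loop_coeff_def)

lemma loop_coeff_divide_ident: "loop_coeff k (\<lambda>t. \<phi> t / t) = loop_coeff (Suc k) \<phi>"
  by (simp add: loop_coeff_def)

lemma loop_coeff_bound:
  assumes "continuous_on (sphere 0 1) \<phi>" "\<And>t. t \<in> sphere 0 1 \<Longrightarrow> norm (\<phi> t) \<le> B"
  shows "norm (loop_coeff k \<phi>) \<le> B"
proof -
  have "norm (\<phi> 1) \<le> B" using assms(2) by simp
  then have B: "0 \<le> B" by (meson norm_ge_zero order_trans)
  have "norm (contour_integral (circlepath 0 1) (\<lambda>t. \<phi> t / t ^ k)) \<le> B * (2 * pi * 1)"
    by (rule has_contour_integral_bound_circlepath[OF has_contour_integral_integral[OF loop_coeff_integrable[OF assms(1)]] B])
       (use assms(2) in \<open>auto simp: norm_divide norm_power\<close>)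
  then show ?thesis by (simp add: loop_coeff_def norm_divide norm_mult field_simps)
qed

lemma loop_coeff_Suc_0:
  assumes "continuous_on (cball 0 1) G" "G holomorphic_on ball 0 1"
    "\<And>t. t \<in> sphere 0 1 \<Longrightarrow> G t = \<phi> t"
  shows "loop_coeff (Suc 0) \<phi> = G 0"
proof -
  have "((\<lambda>u. G u / (u - 0)) has_contour_integral 2 * of_real pi * \<i> * G 0) (circlepath 0 1)"
    by (rule Cauchy_integral_circlepath[OF assms(1,2)]) simp
  then have "loop_coeff (Suc 0) G = G 0"
    by (simp add: loop_coeff_def contour_integral_unique)
  then show ?thesis using loop_coeff_cong[of G \<phi>] assms(3) by simp
qed

lemma loop_coeff_0:
  assumes "disk_loop \<phi>"
  shows "loop_coeff 0 \<phi> = 0"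
proof -
  obtain G where "continuous_on (cball 0 1) G" "G holomorphic_on ball 0 1" "\<forall>t\<in>sphere 0 1. G t = \<phi> t"
    using assms unfolding disk_loop_def by blast
  then have "loop_coeff (Suc 0) (\<lambda>t. t * \<phi> t) = 0 * G 0"
    by (intro loop_coeff_Suc_0 continuous_intros holomorphic_intros) auto
  moreover have "loop_coeff (Suc 0) (\<lambda>t. t * \<phi> t) = loop_coeff 0 (\<lambda>t. t * \<phi> t / t)"
    by (rule loop_coeff_divide_ident[symmetric])
  moreover have "\<dots> = loop_coeff 0 \<phi>" by (rule loop_coeff_cong) auto
  ultimately show ?thesis by simp
qed

lemma loop_coeff_const:
  "loop_coeff (Suc k) (\<lambda>_. c) = (if k = 0 then c else 0)"
proof -
  have "((\<lambda>u. c / (u - 0) ^ Suc k) has_contour_integral ((2 * pi * \<i>) / fact k) * (deriv ^^ k) (\<lambda>_. c) 0) (circlepath 0 1)"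
    by (rule Cauchy_has_contour_integral_higher_derivative_circlepath) auto
  then show ?thesis by (simp add: loop_coeff_def contour_integral_unique)
qed

lemma loop_coeff_has_dz:
  assumes A: "open A" and z: "z \<in> A"
    and d: "\<And>z t. z \<in> A \<Longrightarrow> t \<in> sphere 0 1 \<Longrightarrow> has_dz (\<lambda>z. K z t) (a z t) (b z t) z"
    and ca: "continuous_on (A \<times> sphere 0 1) (\<lambda>(z,t). a z t)"
    and cb: "continuous_on (A \<times> sphere 0 1) (\<lambda>(z,t). b z t)"
    and cK: "\<And>z. z \<in> A \<Longrightarrow> continuous_on (sphere 0 1) (K z)"
  shows "has_dz (\<lambda>z. loop_coeff k (K z)) (loop_coeff k (a z)) (loop_coeff k (b z)) z"
proof -
  have cz: "continuous_on (sphere 0 1) (c z)" if "continuous_on (A \<times> sphere 0 1) (\<lambda>(z,t). c z t)"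
    for c :: "complex \<Rightarrow> complex \<Rightarrow> complex"
    using that z by (auto intro!: continuous_on_compose2[OF that, of _ "\<lambda>t. (z,t)", simplified] continuous_intros)
  note caz = cz[OF ca] and cbz = cz[OF cb]
  show ?thesis
    unfolding has_dz_def has_derivative_at_alt
  proof (intro conjI allI impI)
    show "bounded_linear (\<lambda>v. v * loop_coeff k (a z) + cnj v * loop_coeff k (b z))"
      by (intro bounded_linear_add bounded_linear_mult_const bounded_linear_ident
          bounded_linear_compose[OF bounded_linear_mult_left bounded_linear_cnj])
    fix e :: real assume e: "e > 0"
    obtain d where d0: "d > 0" "ball z d \<subseteq> A" and dd: "\<And>h t. norm h < d \<Longrightarrow> t \<in> sphere 0 1 \<Longrightarrow>
       norm (K (z + h) t - K z t - (h * a z t + cnj h * b z t)) \<le> e * norm h"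
      using uniform_dz[OF A compact_sphere d ca cb z e] by blast
    have "norm (loop_coeff k (K y) - loop_coeff k (K z) - ((y - z) * loop_coeff k (a z) + cnj (y - z) * loop_coeff k (b z)))
          \<le> e * norm (y - z)" if y: "norm (y - z) < d" for y
    proof -
      have yA: "y \<in> A" using y d0 by (auto simp: dist_norm norm_minus_commute)
      note cc = cK[OF yA] cK[OF z] caz cbz
      have "loop_coeff k (K y) - loop_coeff k (K z) - ((y - z) * loop_coeff k (a z) + cnj (y - z) * loop_coeff k (b z))
        = loop_coeff k (\<lambda>t. K y t - K z t - ((y - z) * a z t + cnj (y - z) * b z t))"
        by (simp only: loop_coeff_diff loop_coeff_add loop_coeff_cmult continuous_on_diff
            continuous_on_add continuous_on_mult_left cc)
      also have "norm \<dots> \<le> e * norm (y - z)"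
      proof (rule loop_coeff_bound)
        show "continuous_on (sphere 0 1) (\<lambda>t. K y t - K z t - ((y - z) * a z t + cnj (y - z) * b z t))"
          by (intro continuous_intros cc)
        show "norm (K y t - K z t - ((y - z) * a z t + cnj (y - z) * b z t)) \<le> e * norm (y - z)"
          if "t \<in> sphere 0 1" for t
          using dd[OF y that] by simp
      qed
      finally show ?thesis .
    qed
    then show "\<exists>d>0. \<forall>y. norm (y - z) < d \<longrightarrow>
        norm (loop_coeff k (K y) - loop_coeff k (K z) - ((y - z) * loop_coeff k (a z) + cnj (y - z) * loop_coeff k (b z)))
          \<le> e * norm (y - z)"
      using d0 by blast
  qed
qed

text \<open>The derivatives of the family in the directions \<open>1\<close> and \<open>\<i>\<close> are uniform limits of difference quotients, which
  extend to the disk, and \<open>\<partial>\<^sub>z\<close> is a combination of the two.\<close>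

lemma disk_loop_dz:
  assumes A: "open A" and z: "z \<in> A"
    and d: "\<And>z t. z \<in> A \<Longrightarrow> t \<in> sphere 0 1 \<Longrightarrow> has_dz (\<lambda>z. K z t) (a z t) (b z t) z"
    and ca: "continuous_on (A \<times> sphere 0 1) (\<lambda>(z,t). a z t)"
    and cb: "continuous_on (A \<times> sphere 0 1) (\<lambda>(z,t). b z t)"
    and K: "\<And>z. z \<in> A \<Longrightarrow> disk_loop (K z)"
  shows "disk_loop (a z)"
proof -
  have dir: "disk_loop (\<lambda>t. v * a z t + cnj v * b z t)" if v: "norm v = 1" for v
  proof (rule disk_loop_uniform_limit)
    fix e :: real assume e: "e > 0"
    obtain d where d0: "d > 0" "ball z d \<subseteq> A" and dd: "\<And>h t. norm h < d \<Longrightarrow> t \<in> sphere 0 1 \<Longrightarrow>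
       norm (K (z + h) t - K z t - (h * a z t + cnj h * b z t)) \<le> e * norm h"
      using uniform_dz[OF A compact_sphere d ca cb z e] by blast
    define s where "s = d/2"
    have s: "0 < s" "s < d" using d0 by (auto simp: s_def)
    let ?h = "of_real s * v"
    have nh: "norm ?h = s" using v s by (simp add: norm_mult)
    have "z + ?h \<in> ball z d" using nh s by (simp add: dist_norm)
    then have "z + ?h \<in> A" using d0 by blast
    then have "disk_loop (\<lambda>t. of_real (1/s) * (K (z + ?h) t - K z t))"
      by (intro disk_loop_intros K z)
    moreover have "norm (of_real (1/s) * (K (z + ?h) t - K z t) - (v * a z t + cnj v * b z t)) \<le> e"
      if t: "t \<in> sphere 0 1" for t
    proof -
      have "of_real (1/s) * (K (z + ?h) t - K z t) - (v * a z t + cnj v * b z t)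
          = of_real (1/s) * (K (z + ?h) t - K z t - (?h * a z t + cnj ?h * b z t))"
        using s by (simp add: field_simps)
      also have "norm \<dots> = (1/s) * norm (K (z + ?h) t - K z t - (?h * a z t + cnj ?h * b z t))"
        using s by (simp only: norm_mult norm_of_real) simp
      also have "\<dots> \<le> (1/s) * (e * norm ?h)"
        using s nh t by (intro mult_left_mono dd) auto
      finally show ?thesis using nh s by simp
    qed
    ultimately show "\<exists>\<psi>. disk_loop \<psi> \<and> (\<forall>t\<in>sphere 0 1. norm (\<psi> t - (v * a z t + cnj v * b z t)) \<le> e)"
      by blast
  qed
  have "disk_loop (\<lambda>t. (1/2) * ((1 * a z t + cnj 1 * b z t) + (-\<i>) * (\<i> * a z t + cnj \<i> * b z t)))"
    by (intro disk_loop_add disk_loop_mult disk_loop_const dir) auto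
  then show ?thesis by (rule disk_loop_cong) (simp add: algebra_simps)
qed

text \<open>The shape in which the equation for \<open>F\<^sub>+\<close> is used: division by \<open>t\<close> raises the index.\<close>

lemma loop_coeff_combination:
  assumes "continuous_on (sphere 0 1) a" "continuous_on (sphere 0 1) b"
    "continuous_on (sphere 0 1) d" "continuous_on (sphere 0 1) e"
  shows "loop_coeff k (\<lambda>t. c1 * a t + c2 * (b t / t) - (c3 * (d t / t) + c4 * (e t / t)))
    = c1 * loop_coeff k a + c2 * loop_coeff (Suc k) b - (c3 * loop_coeff (Suc k) d + c4 * loop_coeff (Suc k) e)"
proof -
  have c: "continuous_on (sphere 0 1) (\<lambda>t. f t / t)" if "continuous_on (sphere 0 1) f" for f :: "complex \<Rightarrow> complex"
    using that by (auto intro!: continuous_intros)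
  note cc = assms c[OF assms(2)] c[OF assms(3)] c[OF assms(4)]
  show ?thesis
    by (simp only: loop_coeff_diff loop_coeff_add loop_coeff_cmult loop_coeff_divide_ident cc
        continuous_on_diff continuous_on_add continuous_on_mult_left)
qed

section \<open>Regularity of the conformal factor and of the Hopf differential\<close>

lemma Ck_on_SucI:
  "(\<And>z. z \<in> D \<Longrightarrow> (g has_derivative (\<lambda>v. Re v *\<^sub>R gx z + Im v *\<^sub>R gy z)) (at z)) \<Longrightarrow>
    Ck_on k D gx \<Longrightarrow> Ck_on k D gy \<Longrightarrow> Ck_on (Suc k) D g"
  by (subst Ck_on.simps(2)) (intro exI[of _ gx] exI[of _ gy] conjI ballI)

lemma Ck_on_SucE:
  assumes "Ck_on (Suc k) D g"
  obtains gx gy where "\<And>z. z \<in> D \<Longrightarrow> (g has_derivative (\<lambda>v. Re v *\<^sub>R gx z + Im v *\<^sub>R gy z)) (at z)"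
    "Ck_on k D gx" "Ck_on k D gy"
  using assms by (subst (asm) Ck_on.simps(2)) (elim exE conjE, rule that, rule bspec)

lemma Ck_on_SucD: "Ck_on (Suc k) D g \<Longrightarrow> Ck_on k D g"
proof (induction k arbitrary: g)
  case 0
  then show ?case
    by (auto intro!: continuous_at_imp_continuous_on intro: has_derivative_continuous)
next
  case (Suc k)
  from Suc.prems obtain gx gy where *:
    "\<And>z. z \<in> D \<Longrightarrow> (g has_derivative (\<lambda>v. Re v *\<^sub>R gx z + Im v *\<^sub>R gy z)) (at z)"
    "Ck_on (Suc k) D gx" "Ck_on (Suc k) D gy"
    by (rule Ck_on_SucE) blast
  show ?case
    by (rule Ck_on_SucI[OF *(1) Suc.IH[OF *(2)] Suc.IH[OF *(3)]])
qed

lemma Ck_on_linear: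
  assumes L: "bounded_linear L"
  shows "Ck_on k D g \<Longrightarrow> Ck_on k D (\<lambda>z. L (g z))"
proof (induction k arbitrary: g)
  case 0
  then show ?case using bounded_linear.continuous_on[OF L] by simp
next
  case (Suc k)
  interpret bounded_linear L by fact
  from Suc.prems obtain gx gy where g:
    "\<And>z. z \<in> D \<Longrightarrow> (g has_derivative (\<lambda>v. Re v *\<^sub>R gx z + Im v *\<^sub>R gy z)) (at z)"
    "Ck_on k D gx" "Ck_on k D gy" by (rule Ck_on_SucE) blast
  have "((\<lambda>z. L (g z)) has_derivative (\<lambda>v. Re v *\<^sub>R L (gx z) + Im v *\<^sub>R L (gy z))) (at z)" if "z \<in> D" for z
    using has_derivative[OF g(1)[OF that]] by (simp add: add scale)
  then show ?case by (rule Ck_on_SucI) (use Suc.IH g in auto)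
qed

lemma Ck_on_add: "Ck_on k D f \<Longrightarrow> Ck_on k D g \<Longrightarrow> Ck_on k D (\<lambda>z. f z + g z)"
proof (induction k arbitrary: f g)
  case 0
  then show ?case by (auto intro: continuous_intros)
next
  case (Suc k)
  obtain fx fy where f:
    "\<And>z. z \<in> D \<Longrightarrow> (f has_derivative (\<lambda>v. Re v *\<^sub>R fx z + Im v *\<^sub>R fy z)) (at z)" "Ck_on k D fx" "Ck_on k D fy"
    using Suc.prems(1) by (rule Ck_on_SucE) blast
  obtain gx gy where g:
    "\<And>z. z \<in> D \<Longrightarrow> (g has_derivative (\<lambda>v. Re v *\<^sub>R gx z + Im v *\<^sub>R gy z)) (at z)" "Ck_on k D gx" "Ck_on k D gy"
    using Suc.prems(2) by (rule Ck_on_SucE) blast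
  note * = f g
  have "((\<lambda>z. f z + g z) has_derivative (\<lambda>v. Re v *\<^sub>R (fx z + gx z) + Im v *\<^sub>R (fy z + gy z))) (at z)" if "z \<in> D" for z
    using has_derivative_add[OF *(1)[OF that] *(4)[OF that]] by (simp add: algebra_simps)
  then show ?case by (rule Ck_on_SucI) (use Suc.IH * in auto)
qed

lemma Ck_on_mult:
  fixes f g :: "complex \<Rightarrow> complex"
  shows "Ck_on k D f \<Longrightarrow> Ck_on k D g \<Longrightarrow> Ck_on k D (\<lambda>z. f z * g z)"
proof (induction k arbitrary: f g)
  case 0
  then show ?case by (auto intro: continuous_intros)
next
  case (Suc k)
  obtain fx fy where f:
    "\<And>z. z \<in> D \<Longrightarrow> (f has_derivative (\<lambda>v. Re v *\<^sub>R fx z + Im v *\<^sub>R fy z)) (at z)" "Ck_on k D fx" "Ck_on k D fy"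
    using Suc.prems(1) by (rule Ck_on_SucE) blast
  obtain gx gy where g:
    "\<And>z. z \<in> D \<Longrightarrow> (g has_derivative (\<lambda>v. Re v *\<^sub>R gx z + Im v *\<^sub>R gy z)) (at z)" "Ck_on k D gx" "Ck_on k D gy"
    using Suc.prems(2) by (rule Ck_on_SucE) blast
  note * = f g
  have "((\<lambda>z. f z * g z) has_derivative (\<lambda>v. Re v *\<^sub>R (fx z * g z + f z * gx z) + Im v *\<^sub>R (fy z * g z + f z * gy z))) (at z)" if "z \<in> D" for z
    using has_derivative_mult[OF *(1)[OF that] *(4)[OF that]] by (simp add: algebra_simps)
  moreover have "Ck_on k D (\<lambda>z. fx z * g z + f z * gx z)" "Ck_on k D (\<lambda>z. fy z * g z + f z * gy z)"
    using * Ck_on_SucD[OF Suc.prems(1)] Ck_on_SucD[OF Suc.prems(2)] by (auto intro!: Ck_on_add Suc.IH)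
  ultimately show ?case by (rule Ck_on_SucI)
qed

lemma Ck_on_cmult: "Ck_on k D f \<Longrightarrow> Ck_on k D (\<lambda>z. (c::complex) * f z)"
  by (rule Ck_on_linear[OF bounded_linear_mult_right])

lemma Ck_on_diff:
  fixes f g :: "complex \<Rightarrow> complex"
  shows "Ck_on k D f \<Longrightarrow> Ck_on k D g \<Longrightarrow> Ck_on k D (\<lambda>z. f z - g z)"
  using Ck_on_add[OF _ Ck_on_cmult[of k D g "-1"]] by simp

lemma Ck_on_cong:
  assumes "Ck_on k D f" "open D" "\<And>z. z \<in> D \<Longrightarrow> f z = g z"
  shows "Ck_on k D g"
proof (cases k)
  case 0
  then show ?thesis using assms by (auto intro: continuous_on_eq)
next
  case (Suc n)
  obtain gx gy where *:
    "\<And>z. z \<in> D \<Longrightarrow> (f has_derivative (\<lambda>v. Re v *\<^sub>R gx z + Im v *\<^sub>R gy z)) (at z)"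
    "Ck_on n D gx" "Ck_on n D gy" using assms(1)[unfolded Suc] by (rule Ck_on_SucE) blast
  have "(g has_derivative (\<lambda>v. Re v *\<^sub>R gx z + Im v *\<^sub>R gy z)) (at z)" if "z \<in> D" for z
    using has_derivative_transform_within_open[OF *(1)[OF that] assms(2) that] assms(3) by blast
  then show ?thesis unfolding Suc by (rule Ck_on_SucI[OF _ *(2,3)])
qed

lemma Ck_on_differentiable: "Ck_on (Suc k) D g \<Longrightarrow> z \<in> D \<Longrightarrow> g differentiable (at z)"
  unfolding differentiable_def by auto

lemma Ck_on_wirt:
  assumes g: "Ck_on (Suc k) D g" and D: "open D"
  shows "Ck_on k D (wirt g)" "Ck_on k D (wirt_bar g)"
proof -
  from g obtain gx gy where *: "\<forall>z\<in>D. (g has_derivative (\<lambda>v. Re v *\<^sub>R gx z + Im v *\<^sub>R gy z)) (at z)"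
    "Ck_on k D gx" "Ck_on k D gy" by auto
  have fd: "frechet_derivative g (at z) = (\<lambda>v. Re v *\<^sub>R gx z + Im v *\<^sub>R gy z)" if "z \<in> D" for z
    using frechet_derivative_at[OF *(1)[rule_format, OF that]] by simp
  show "Ck_on k D (wirt g)"
    by (rule Ck_on_cong[OF Ck_on_cmult[OF Ck_on_diff[OF *(2) Ck_on_cmult[OF *(3), of \<i>]], of "1/2"] D])
      (simp add: wirt_def fd)
  show "Ck_on k D (wirt_bar g)"
    by (rule Ck_on_cong[OF Ck_on_cmult[OF Ck_on_add[OF *(2) Ck_on_cmult[OF *(3), of \<i>]], of "1/2"] D])
      (simp add: wirt_bar_def fd)
qed

text \<open>\<open>u\<close> is recovered as half the logarithm of \<open>2 \<langle>f\<^sub>z, f\<^bsub>\<bar>z\<^esub>\<rangle>\<close>.\<close>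

lemma conformal_factor_C1:
  assumes D: "open D" and f: "conformal_immersion D f u"
  shows "Ck_on (Suc 0) D (\<lambda>z. complex_of_real (u z))"
proof -
  let ?f = "\<lambda>i z. complex_of_real (f z $ i)"
  have "Ck_on k D (?f i)" for k i
    using f Ck_on_linear[OF bounded_linear_compose[OF bounded_linear_of_real bounded_linear_vec_nth[of i]]]
    unfolding conformal_immersion_def smooth_on_def by blast
  then have w: "Ck_on (Suc 0) D (wirt (?f i))" "Ck_on (Suc 0) D (wirt_bar (?f i))" for i
    using Ck_on_wirt[OF _ D] by blast+
  define X where "X = (\<lambda>z. lorentz (vwirt (cvec \<circ> f) z) (vwirt_bar (cvec \<circ> f) z))"
  have "Ck_on (Suc 0) D X"
    unfolding X_def lorentz_def vwirt_def vwirt_bar_def cvec_def vec_lambda_beta comp_def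
    by (intro Ck_on_add Ck_on_diff Ck_on_mult w)
  then obtain Xx Xy where X: "\<And>z. z \<in> D \<Longrightarrow> (X has_derivative (\<lambda>v. Re v *\<^sub>R Xx z + Im v *\<^sub>R Xy z)) (at z)"
    "continuous_on D Xx" "continuous_on D Xy" "continuous_on D X"
    using Ck_on_SucD[of 0 D X] by auto
  have Xu: "X z = of_real (exp (2 * u z) / 2)" if "z \<in> D" for z
    using f that by (auto simp: conformal_immersion_def X_def)
  have X0: "X z \<noteq> 0" if "z \<in> D" for z
    unfolding Xu[OF that] of_real_eq_0_iff by simp
  have X2: "2 * X z \<notin> \<real>\<^sub>\<le>\<^sub>0" if "z \<in> D" for z
  proof -
    have "2 * X z = of_real (exp (2 * u z))" using Xu[OF that] by (simp add: mult.commute)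
    then show ?thesis by (simp only: nonpos_Reals_of_real_iff) simp
  qed
  have "Ck_on (Suc 0) D (\<lambda>z. Ln (2 * X z) / 2)"
    unfolding Ck_on.simps
  proof (intro exI conjI ballI)
    show "continuous_on D (\<lambda>z. Xx z / (2 * X z))" "continuous_on D (\<lambda>z. Xy z / (2 * X z))"
      using X X0 by (auto intro!: continuous_intros)
    fix z assume z: "z \<in> D"
    have "((\<lambda>y. Ln (2 * y) / 2) has_field_derivative (inverse (2 * X z))) (at (X z))"
      using DERIV_cdivide[OF DERIV_chain2[OF has_field_derivative_Ln[OF X2[OF z]] DERIV_cmult_Id], of 2] by simp
    then have "((\<lambda>y. Ln (2 * y) / 2) has_derivative (*) (inverse (2 * X z))) (at (X z))"
      by (simp add: has_field_derivative_def)
    from has_derivative_compose[OF X(1)[OF z] this]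
    show "((\<lambda>z. Ln (2 * X z) / 2) has_derivative (\<lambda>v. Re v *\<^sub>R (Xx z / (2 * X z)) + Im v *\<^sub>R (Xy z / (2 * X z)))) (at z)"
      by (rule has_derivative_eq_rhs)
        (simp only: fun_eq_iff scaleR_conv_of_real divide_inverse distrib_left mult.assoc mult.left_commute mult.commute, simp)
  qed
  then show ?thesis
  proof (rule Ck_on_cong[OF _ D])
    fix z assume "z \<in> D"
    then have "2 * X z = of_real (exp (2 * u z))" using Xu by (simp add: mult.commute)
    then show "Ln (2 * X z) / 2 = of_real (u z)" by (simp add: Ln_of_real)
  qed
qed

lemma hopf_continuous:
  assumes D: "open D" and f: "conformal_immersion D f u" and N: "unit_normal D f N"
  shows "continuous_on D (hopf f N)"
proof -
  let ?f = "\<lambda>i z. complex_of_real (f z $ i)"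
  have "Ck_on k D (?f i)" for k i
    using f Ck_on_linear[OF bounded_linear_compose[OF bounded_linear_of_real bounded_linear_vec_nth[of i]]]
    unfolding conformal_immersion_def smooth_on_def by blast
  then have "Ck_on 0 D (wirt (wirt (?f i)))" for i
    using Ck_on_wirt[OF Ck_on_wirt(1) D, OF _ D] by blast
  then have w: "continuous_on D (wirt (wirt (?f i)))" for i by simp
  have "Ck_on 0 D N" using N unfolding unit_normal_def smooth_on_def by blast
  then have n: "continuous_on D N" by simp
  have "continuous_on D (\<lambda>z. lorentz (vwirt (vwirt (cvec \<circ> f)) z) (cvec (N z)))"
    unfolding lorentz_def vwirt_def cvec_def vec_lambda_beta comp_def
    by (intro continuous_intros w n)
  then show ?thesis by (simp add: hopf_def)
qed

section \<open>Calculus of 2 by 2 matrices\<close>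

(* Leaves a single reading of the infix for components. *)
no_notation fps_nth (infixl "$" 75)

lemma matrix_mult_nth2:
  fixes M N :: cmat2
  shows "(M ** N) $ i $ j = M $ i $ 1 * N $ 1 $ j + M $ i $ 2 * N $ 2 $ j"
  by (simp add: matrix_matrix_mult_def sum_2)

lemma mat2_nth [simp]:
  "mat2 a b c d $ 1 $ 1 = a" "mat2 a b c d $ 1 $ 2 = b"
  "mat2 a b c d $ 2 $ 1 = c" "mat2 a b c d $ 2 $ 2 = d"
  by (simp_all add: mat2_def)

lemma cscale_nth [simp]: "cscale c M $ i $ j = c * M $ i $ j"
  by (simp add: cscale_def)

lemma cmat2_eq_iff:
  fixes M N :: cmat2
  shows "M = N \<longleftrightarrow> M$1$1 = N$1$1 \<and> M$1$2 = N$1$2 \<and> M$2$1 = N$2$1 \<and> M$2$2 = N$2$2"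
  by (auto simp: vec_eq_iff forall_2)

lemma mat_1_nth2 [simp]:
  "(mat 1 :: cmat2) $ 1 $ 1 = 1" "(mat 1 :: cmat2) $ 1 $ 2 = 0"
  "(mat 1 :: cmat2) $ 2 $ 1 = 0" "(mat 1 :: cmat2) $ 2 $ 2 = 1"
  by (simp_all add: mat_def)

definition adjugate2 :: "cmat2 \<Rightarrow> cmat2" where
  "adjugate2 M = mat2 (M$2$2) (- (M$1$2)) (- (M$2$1)) (M$1$1)"

lemma adjugate2_mult:
  assumes "det M = 1"
  shows "adjugate2 M ** M = mat 1" "M ** adjugate2 M = mat 1"
  using assms by (simp_all add: cmat2_eq_iff matrix_mult_nth2 adjugate2_def det_2 mult.commute)

lemma cmat2_inv_eqI:
  fixes M N :: cmat2
  assumes "M ** N = mat 1" "N ** M = mat 1"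
  shows "matrix_inv M = N"
proof -
  have "\<exists>A'. M ** A' = mat 1 \<and> A' ** M = mat 1" using assms by blast
  then have "M ** matrix_inv M = mat 1 \<and> matrix_inv M ** M = mat 1"
    unfolding matrix_inv_def by (rule someI_ex)
  then have "N ** (M ** matrix_inv M) = N" by simp
  then show ?thesis by (simp add: matrix_mul_assoc assms)
qed

text \<open>Entrywise, with \<open>a\<close> and \<open>b\<close> the coefficients of \<open>dz\<close> and \<open>d\<bar>z\<close>.\<close>

definition has_mdz :: "(complex \<Rightarrow> cmat2) \<Rightarrow> cmat2 \<Rightarrow> cmat2 \<Rightarrow> complex \<Rightarrow> bool" where
  "has_mdz M a b z \<longleftrightarrow> (\<forall>i j. has_dz (\<lambda>z. M z $ i $ j) (a $ i $ j) (b $ i $ j) z)"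

lemma has_mdz_unique: "has_mdz M a b z \<Longrightarrow> has_mdz M a' b' z \<Longrightarrow> a = a' \<and> b = b'"
  unfolding has_mdz_def vec_eq_iff by (meson has_dz_unique)

lemma has_mdz_cong:
  assumes "has_mdz M a b z" "open W" "z \<in> W" "\<And>x. x \<in> W \<Longrightarrow> M x = N x"
  shows "has_mdz N a b z"
  unfolding has_mdz_def
proof (intro allI)
  fix i j
  show "has_dz (\<lambda>z. N z $ i $ j) (a $ i $ j) (b $ i $ j) z"
    by (rule has_dz_cong[of "\<lambda>z. M z $ i $ j" _ _ _ W]) (use assms in \<open>auto simp: has_mdz_def\<close>)
qed

lemma has_mdz_mult:
  assumes "has_mdz M a b z" "has_mdz N a' b' z"
  shows "has_mdz (\<lambda>x. M x ** N x) (a ** N z + M z ** a') (b ** N z + M z ** b') z"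
  unfolding has_mdz_def
proof (intro allI)
  fix i j
  have d: "has_dz (\<lambda>x. M x $ i $ k * N x $ k $ j) (a$i$k * N z$k$j + M z$i$k * a'$k$j)
      (b$i$k * N z$k$j + M z$i$k * b'$k$j) z" for k
    using assms unfolding has_mdz_def by (intro has_dz_mult) auto
  show "has_dz (\<lambda>x. (M x ** N x) $ i $ j) ((a ** N z + M z ** a') $ i $ j) ((b ** N z + M z ** b') $ i $ j) z"
    using has_dz_add[OF d[of 1] d[of 2]] by (simp add: matrix_mult_nth2 algebra_simps)
qed

lemma has_mdz_adjugate2:
  assumes "has_mdz M a b z"
  shows "has_mdz (\<lambda>x. adjugate2 (M x)) (adjugate2 a) (adjugate2 b) z"
proof -
  have d: "has_dz (\<lambda>x. M x $ i $ j) (a $ i $ j) (b $ i $ j) z" for i j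
    using assms by (simp add: has_mdz_def)
  show ?thesis
    using d has_dz_cmult[OF d, of "-1"] unfolding has_mdz_def forall_2 adjugate2_def by simp
qed

lemma has_mdz_maurer_cartan:
  assumes g: "g differentiable (at z)" and det: "det (g z) = 1"
    and mc: "\<And>v. maurer_cartan g z v = cscale v X + cscale (cnj v) Y"
  shows "has_mdz g (g z ** X) (g z ** Y) z"
  unfolding has_mdz_def has_dz_def
proof (intro allI)
  fix i j
  let ?L = "frechet_derivative g (at z)"
  have L: "(g has_derivative ?L) (at z)"
    using g by (simp add: frechet_derivative_works)
  have "?L v = g z ** (cscale v X + cscale (cnj v) Y)" for v
    unfolding mc[symmetric] maurer_cartan_def
    using adjugate2_mult[OF det] by (simp add: cmat2_inv_eqI[of "g z" "adjugate2 (g z)"] matrix_mul_assoc)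
  then have "?L v $ i $ j = v * (g z ** X) $ i $ j + cnj v * (g z ** Y) $ i $ j" for v
    by (simp add: matrix_mult_nth2 algebra_simps)
  moreover have "((\<lambda>w. g w $ i $ j) has_derivative (\<lambda>v. ?L v $ i $ j)) (at z)"
    by (intro bounded_linear.has_derivative[OF bounded_linear_vec_nth] L)
  ultimately show "((\<lambda>w. g w $ i $ j) has_derivative
      (\<lambda>v. v * (g z ** X) $ i $ j + cnj v * (g z ** Y) $ i $ j)) (at z)" by simp
qed

text \<open>Product rule for \<open>F = M N\<close>, solved for the derivative of \<open>N\<close>.\<close>

lemma has_mdz_right_factor:
  assumes W: "open W" "z \<in> W" and F: "has_mdz F (F z ** Omega_z) (F z ** Omega_zb) z"
    and M: "has_mdz M (M z ** dlog_Fm) 0 z"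
    and FMN: "\<And>x. x \<in> W \<Longrightarrow> F x = M x ** N x" and det: "\<And>x. x \<in> W \<Longrightarrow> det (M x) = 1"
  shows "has_mdz N (N z ** Omega_z - dlog_Fm ** N z) (N z ** Omega_zb) z"
proof -
  have N: "adjugate2 (M x) ** F x = N x" if "x \<in> W" for x
    using FMN[OF that] adjugate2_mult[OF det[OF that]] by (simp add: matrix_mul_assoc)
  obtain a b where ab: "has_mdz N a b z"
    using has_mdz_cong[OF has_mdz_mult[OF has_mdz_adjugate2[OF M] F] W N] by blast
  have "has_mdz F ((M z ** dlog_Fm) ** N z + M z ** a) (0 ** N z + M z ** b) z"
    using has_mdz_cong[OF has_mdz_mult[OF M ab] W] FMN by metis
  from has_mdz_unique[OF this F] have
    a: "(M z ** dlog_Fm) ** N z + M z ** a = F z ** Omega_z" and b: "M z ** b = F z ** Omega_zb"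
    by simp_all
  have adj: "adjugate2 (M z) ** (M z ** X) = X" for X
    using adjugate2_mult[OF det[OF W(2)]] by (simp add: matrix_mul_assoc)
  have "b = N z ** Omega_zb"
    using arg_cong[OF b, of "(**) (adjugate2 (M z))"] FMN[OF W(2)]
    by (simp add: adj flip: matrix_mul_assoc)
  moreover have "dlog_Fm ** N z + a = N z ** Omega_z"
    using arg_cong[OF a, of "(**) (adjugate2 (M z))"] FMN[OF W(2)]
    by (simp add: adj matrix_add_ldistrib flip: matrix_mul_assoc)
  then have "a = N z ** Omega_z - dlog_Fm ** N z" by (simp add: algebra_simps)
  ultimately show ?thesis using ab by simp
qed

section \<open>Splittings of an adjusted frame\<close>

text \<open>The analytic content of a splitting \<open>F = F\<^sub>- F\<^sub>+\<close> of the adjusted frame over an open set \<open>A\<close>. The exterior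
  extension of \<open>F\<^sub>-\<close> is expressed through the inverted loop \<open>t \<mapsto> F\<^sub>-(cnj t)\<close>, so that only extensions to
  the disk occur; the bound on \<open>F\<close> comes from unitarity.\<close>

locale loop_splitting =
  fixes A :: "complex set" and u :: "complex \<Rightarrow> real" and Q :: "complex \<Rightarrow> complex" and s :: complex
    and ux uy :: "complex \<Rightarrow> complex" and F Fm Fp P :: "complex \<Rightarrow> complex \<Rightarrow> cmat2"
  assumes open_A: "open A"
    and s: "s \<noteq> 0"
    and du: "\<And>z. z \<in> A \<Longrightarrow> has_dz (\<lambda>w. of_real (u w)) (ux z) (uy z) z"
    and cux: "continuous_on A ux" and cuy: "continuous_on A uy" and cQ: "continuous_on A Q"
    and dF: "\<And>z t. z \<in> A \<Longrightarrow> t \<in> sphere 0 1 \<Longrightarrow> has_mdz (\<lambda>\<zeta>. F \<zeta> t)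
        (F z t ** mat2 (- ux z / 2) (- inverse t * of_real (exp (- u z)) * Q z)
                 (inverse t * of_real (exp (u z)) / 2 * s) (ux z / 2))
        (F z t ** mat2 (uy z / 2) (- t * of_real (exp (u z)) / 2 * s)
                 (t * of_real (exp (- u z)) * cnj (Q z)) (- uy z / 2)) z"
    and F_loop: "\<And>z i j. z \<in> A \<Longrightarrow> continuous_on (sphere 0 1) (\<lambda>t. F z t $ i $ j)"
    and F_bound: "\<And>z t i j. z \<in> A \<Longrightarrow> t \<in> sphere 0 1 \<Longrightarrow> norm (F z t $ i $ j) \<le> 1"
    and cFm: "\<And>i j. continuous_on (A \<times> sphere 0 1) (\<lambda>(z,t). Fm z t $ i $ j)"
    and dFm: "\<And>z t. z \<in> A \<Longrightarrow> t \<in> sphere 0 1 \<Longrightarrow> has_mdz (\<lambda>\<zeta>. Fm \<zeta> t) (Fm z t ** cscale (inverse t) (P z t)) 0 z"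
    and F_eq: "\<And>z t. z \<in> A \<Longrightarrow> t \<in> sphere 0 1 \<Longrightarrow> F z t = Fm z t ** Fp z t"
    and detm: "\<And>z t. z \<in> A \<Longrightarrow> t \<in> sphere 0 1 \<Longrightarrow> det (Fm z t) = 1"
    and detp: "\<And>z t. z \<in> A \<Longrightarrow> t \<in> sphere 0 1 \<Longrightarrow> det (Fp z t) = 1"
    and Fp_disk: "\<And>z i j. z \<in> A \<Longrightarrow> disk_loop (\<lambda>t. Fp z t $ i $ j)"
    and Fm_disk: "\<And>z i j. z \<in> A \<Longrightarrow> \<exists>G. continuous_on (cball 0 1) G \<and> G holomorphic_on ball 0 1
        \<and> (\<forall>t\<in>sphere 0 1. G t = Fm z (cnj t) $ i $ j) \<and> G 0 = (mat 1 :: cmat2) $ i $ j"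
    and twist: "\<And>z t. z \<in> A \<Longrightarrow> t \<in> sphere 0 1 \<Longrightarrow> Fp z (- t) $ 1 $ 2 = - Fp z t $ 1 $ 2
        \<and> Fp z (- t) $ 2 $ 1 = - Fp z t $ 2 $ 1"
begin

abbreviation "T \<equiv> sphere (0::complex) 1"

definition "Omega_z z t = mat2 (- ux z / 2) (- inverse t * of_real (exp (- u z)) * Q z)
                 (inverse t * of_real (exp (u z)) / 2 * s) (ux z / 2)"
definition "Omega_zb z t = mat2 (uy z / 2) (- t * of_real (exp (u z)) / 2 * s)
                 (t * of_real (exp (- u z)) * cnj (Q z)) (- uy z / 2)"
definition "dlog_Fm z t = cscale (inverse t) (P z t)"
definition "dFm_dz z t = (\<chi> i j. deriv (\<lambda>\<zeta>. Fm \<zeta> t $ i $ j) z) "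
definition "dFp_dz z t = Fp z t ** Omega_z z t - dlog_Fm z t ** Fp z t"

definition "cont_loops M \<longleftrightarrow> (\<forall>i j. continuous_on (A \<times> T) (\<lambda>(z,t). (M z t :: cmat2) $ i $ j))"

lemma cont_loops_mult: "cont_loops M \<Longrightarrow> cont_loops N \<Longrightarrow> cont_loops (\<lambda>z t. M z t ** N z t)"
  unfolding cont_loops_def case_prod_unfold matrix_mult_nth2
  by (intro allI continuous_on_add continuous_on_mult) blast+

lemma cont_loops_diff: "cont_loops M \<Longrightarrow> cont_loops N \<Longrightarrow> cont_loops (\<lambda>z t. M z t - N z t)"
  unfolding cont_loops_def case_prod_unfold vector_minus_component
  by (intro allI continuous_on_diff) blast+

lemma cont_loops_adjugate2: "cont_loops M \<Longrightarrow> cont_loops (\<lambda>z t. adjugate2 (M z t))"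
  unfolding cont_loops_def case_prod_unfold adjugate2_def forall_2 mat2_nth
  by (intro conjI continuous_on_minus) blast+

lemma cont_loops_cong:
  assumes "cont_loops M" "\<And>z t. z \<in> A \<Longrightarrow> t \<in> T \<Longrightarrow> M z t = N z t"
  shows "cont_loops N"
  unfolding cont_loops_def
proof (intro allI)
  fix i j
  show "continuous_on (A \<times> T) (\<lambda>(z,t). N z t $ i $ j)"
    by (rule continuous_on_eq[of _ "\<lambda>(z,t). M z t $ i $ j"])
      (use assms in \<open>auto simp: cont_loops_def\<close>)
qed

lemma cont_loops_slice:
  assumes "cont_loops M" "z \<in> A"
  shows "continuous_on T (\<lambda>t. M z t $ i $ j)"
proof -
  have "continuous_on (A \<times> T) (\<lambda>(z,t). M z t $ i $ j)" using assms(1) by (simp add: cont_loops_def)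
  then have "continuous_on T (\<lambda>t. (\<lambda>(z,t). M z t $ i $ j) (z, t))"
    by (rule continuous_on_compose2) (use assms(2) in \<open>auto intro: continuous_intros\<close>)
  then show ?thesis by simp
qed

lemma cont_u: "continuous_on A u"
proof -
  have "continuous_on A (\<lambda>w. complex_of_real (u w))"
    by (rule continuous_at_imp_continuous_on) (use du has_dz_continuous in blast)
  then have "continuous_on A (\<lambda>w. Re (complex_of_real (u w)))" by (rule continuous_on_Re)
  then show ?thesis by simp
qed

lemma cont_Omega: "cont_loops Omega_z" "cont_loops Omega_zb"
proof -
  have p: "continuous_on (A \<times> T) (\<lambda>p. g (fst p))" if "continuous_on A g" for g :: "complex \<Rightarrow> 'a::topological_space"
    using that by (rule continuous_on_compose2[of A]) (auto intro: continuous_intros)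
  note c = p[OF cont_u] p[OF cux] p[OF cuy] p[OF cQ]
  show "cont_loops Omega_z" "cont_loops Omega_zb"
    unfolding cont_loops_def Omega_z_def Omega_zb_def case_prod_unfold forall_2 mat2_nth
    by (auto intro!: continuous_intros c)
qed

lemma Fm_holo: "t \<in> T \<Longrightarrow> (\<lambda>\<zeta>. Fm \<zeta> t $ i $ j) holomorphic_on A"
  using dFm has_dz_imp_field open_A unfolding has_mdz_def holomorphic_on_open[OF open_A] by fastforce

lemma dFm_dz_eq: "z \<in> A \<Longrightarrow> t \<in> T \<Longrightarrow> dFm_dz z t = Fm z t ** dlog_Fm z t"
  unfolding dFm_dz_def dlog_Fm_def vec_eq_iff vec_lambda_beta
  using dFm has_dz_imp_field DERIV_imp_deriv unfolding has_mdz_def by fastforce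

lemma cont_dFm_dz: "cont_loops dFm_dz"
  unfolding cont_loops_def dFm_dz_def vec_lambda_beta
  by (intro allI continuous_on_deriv_param open_A cFm Fm_holo)

lemma cont_Fm: "cont_loops Fm"
  using cFm by (auto simp: cont_loops_def)

text \<open>Unitarity bounds \<open>F\<close>, and the frame equation then bounds its derivative locally uniformly in \<open>\<theta>\<close>.\<close>

lemma cont_F: "cont_loops F"
proof -
  have bd: "\<exists>M. \<forall>x\<in>cball z r. \<forall>t\<in>T. norm ((F x t ** X x t) $ i $ j) \<le> M"
    if "cball z r \<subseteq> A" and X: "cont_loops X" for z r X i j
  proof -
    have "\<exists>M. \<forall>x\<in>cball z r. \<forall>t\<in>T. norm (X x t $ k $ j) \<le> M" for k
    proof -
      have "continuous_on (cball z r \<times> T) (\<lambda>(z,t). X z t $ k $ j)"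
        using X that(1) unfolding cont_loops_def by (blast intro: continuous_on_subset)
      then have "bounded ((\<lambda>(z,t). X z t $ k $ j) ` (cball z r \<times> T))"
        by (intro compact_imp_bounded compact_continuous_image compact_Times compact_cball compact_sphere)
      then obtain M where "\<forall>x \<in> (\<lambda>(z,t). X z t $ k $ j) ` (cball z r \<times> T). norm x \<le> M"
        unfolding bounded_iff by blast
      then show ?thesis by (intro exI[of _ M]) force
    qed
    then obtain M where M: "\<And>k x t. x \<in> cball z r \<Longrightarrow> t \<in> T \<Longrightarrow> norm (X x t $ k $ j) \<le> M k" by metis
    have "norm ((F x t ** X x t) $ i $ j) \<le> 1 * M 1 + 1 * M 2" if x: "x \<in> cball z r" and t: "t \<in> T" for x t
    proof -
      have "x \<in> A" using x \<open>cball z r \<subseteq> A\<close> by blast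
      then have "norm (F x t $ i $ k * X x t $ k $ j) \<le> 1 * M k" for k
        unfolding norm_mult using F_bound M x t by (intro mult_mono) auto
      then show ?thesis unfolding matrix_mult_nth2 by (intro norm_triangle_mono)
    qed
    then show ?thesis by blast
  qed
  have bd2: "\<exists>M. \<forall>x\<in>cball z r. \<forall>t\<in>T. norm ((F x t ** Omega_z x t) $ i $ j) \<le> M \<and> norm ((F x t ** Omega_zb x t) $ i $ j) \<le> M"
    if B: "cball z r \<subseteq> A" for z r i j
  proof -
    obtain M1 where "\<forall>x\<in>cball z r. \<forall>t\<in>T. norm ((F x t ** Omega_z x t) $ i $ j) \<le> M1" using bd[OF B cont_Omega(1)] by blast
    moreover obtain M2 where "\<forall>x\<in>cball z r. \<forall>t\<in>T. norm ((F x t ** Omega_zb x t) $ i $ j) \<le> M2" using bd[OF B cont_Omega(2)] by blast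
    ultimately show ?thesis by (intro exI[of _ "max M1 M2"]) (auto simp: le_max_iff_disj)
  qed
  have "continuous_on (A \<times> T) (\<lambda>(z,t). F z t $ i $ j)" for i j
    by (rule continuous_on_param_of_bounded_dz[where K = "\<lambda>z t. F z t $ i $ j", OF open_A _ _ bd2])
      (use dF F_loop in \<open>auto simp: has_mdz_def Omega_z_def Omega_zb_def\<close>)
  then show ?thesis by (simp add: cont_loops_def)
qed

lemma dlog_Fm_eq: "z \<in> A \<Longrightarrow> t \<in> T \<Longrightarrow> dlog_Fm z t = adjugate2 (Fm z t) ** dFm_dz z t"
  using dFm_dz_eq adjugate2_mult[OF detm] by (simp add: matrix_mul_assoc)

lemma P_eq_dlog_Fm: "t \<in> T \<Longrightarrow> P z t = cscale t (dlog_Fm z t)"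
  by (cases "t = 0") (auto simp: dlog_Fm_def vec_eq_iff)

lemma cont_dlog_Fm: "cont_loops dlog_Fm"
  by (rule cont_loops_cong[OF cont_loops_mult[OF cont_loops_adjugate2[OF cont_Fm] cont_dFm_dz]]) (simp add: dlog_Fm_eq)

lemma Fp_eq: "z \<in> A \<Longrightarrow> t \<in> T \<Longrightarrow> Fp z t = adjugate2 (Fm z t) ** F z t"
  using F_eq adjugate2_mult[OF detm] by (simp add: matrix_mul_assoc)

lemma cont_Fp: "cont_loops Fp"
  by (rule cont_loops_cong[OF cont_loops_mult[OF cont_loops_adjugate2[OF cont_Fm] cont_F]]) (simp add: Fp_eq)

lemma cont_dFp_dz: "cont_loops dFp_dz"
  unfolding dFp_dz_def by (intro cont_loops_diff cont_loops_mult cont_Fp cont_Omega cont_dlog_Fm)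

lemma has_dz_Fp:
  assumes "z \<in> A" "t \<in> T"
  shows "has_dz (\<lambda>\<zeta>. Fp \<zeta> t $ i $ j) (dFp_dz z t $ i $ j) ((Fp z t ** Omega_zb z t) $ i $ j) z"
proof -
  have "has_mdz (\<lambda>\<zeta>. Fp \<zeta> t) (Fp z t ** Omega_z z t - dlog_Fm z t ** Fp z t) (Fp z t ** Omega_zb z t) z"
    by (rule has_mdz_right_factor[OF open_A assms(1), where F = "\<lambda>\<zeta>. F \<zeta> t" and M = "\<lambda>\<zeta>. Fm \<zeta> t"])
      (use assms dF dFm F_eq detm in \<open>auto simp: Omega_z_def Omega_zb_def dlog_Fm_def\<close>)
  then show ?thesis by (simp add: has_mdz_def dFp_dz_def)
qed

lemma dFp_dz_disk: "z \<in> A \<Longrightarrow> disk_loop (\<lambda>t. dFp_dz z t $ i $ j)"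
  by (rule disk_loop_dz[where K = "\<lambda>z t. Fp z t $ i $ j" and b = "\<lambda>z t. (Fp z t ** Omega_zb z t) $ i $ j" and A = A])
    (use open_A has_dz_Fp cont_dFp_dz cont_loops_mult[OF cont_Fp cont_Omega(2)] Fp_disk in \<open>auto simp: cont_loops_def\<close>)

text \<open>The equation for \<open>F\<^sub>+\<close>, multiplied by \<open>t\<close> and solved for \<open>P\<close>; the pole of the adjusted form at
  \<open>t = 0\<close> is simple, so \<open>B t = t \<Omega>'\<close> has no pole.\<close>

lemma P_disk: "z \<in> A \<Longrightarrow> disk_loop (\<lambda>t. P z t $ i $ j)"
proof -
  assume z: "z \<in> A"
  define B where "B t = mat2 (- t * ux z / 2) (- of_real (exp (- u z)) * Q z)
                 (of_real (exp (u z)) / 2 * s) (t * ux z / 2)" for t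
  have B: "disk_loop (\<lambda>t. B t $ i $ j)" for i j
  proof -
    have "\<forall>i j. disk_loop (\<lambda>t. B t $ i $ j)"
      using disk_loop_mult[OF disk_loop_ident disk_loop_const, of "ux z / 2"]
        disk_loop_mult[OF disk_loop_ident disk_loop_const, of "- ux z / 2"]
      unfolding forall_2 B_def by (simp add: disk_loop_const)
    then show ?thesis by blast
  qed
  have adj: "disk_loop (\<lambda>t. adjugate2 (Fp z t) $ i $ j)" for i j
  proof -
    have "\<forall>i j. disk_loop (\<lambda>t. adjugate2 (Fp z t) $ i $ j)"
      unfolding forall_2 adjugate2_def using Fp_disk[OF z] by (auto intro: disk_loop_uminus)
    then show ?thesis by blast
  qed
  have eq: "((Fp z t ** B t - cscale t (dFp_dz z t)) ** adjugate2 (Fp z t)) = P z t" if t: "t \<in> T" for t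
  proof -
    have t0: "t \<noteq> 0" using t by auto
    have "B t = cscale t (Omega_z z t)" using t0 by (simp add: B_def Omega_z_def cmat2_eq_iff)
    then have "Fp z t ** B t = cscale t (Fp z t ** Omega_z z t)"
      by (simp add: cmat2_eq_iff matrix_mult_nth2 algebra_simps)
    moreover have "cscale t (dFp_dz z t) = cscale t (Fp z t ** Omega_z z t) - cscale t (dlog_Fm z t) ** Fp z t"
      by (simp add: dFp_dz_def cmat2_eq_iff matrix_mult_nth2 algebra_simps)
    ultimately have "Fp z t ** B t - cscale t (dFp_dz z t) = P z t ** Fp z t"
      by (simp add: P_eq_dlog_Fm[OF t])
    then have "((Fp z t ** B t - cscale t (dFp_dz z t)) ** adjugate2 (Fp z t))
        = P z t ** (Fp z t ** adjugate2 (Fp z t))" by (simp add: matrix_mul_assoc)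
    then show ?thesis using adjugate2_mult[OF detp[OF z t]] by simp
  qed
  have "disk_loop (\<lambda>t. ((Fp z t ** B t - cscale t (dFp_dz z t)) ** adjugate2 (Fp z t)) $ i $ j)"
    unfolding matrix_mult_nth2 vector_minus_component cscale_nth
    by (intro disk_loop_add disk_loop_mult disk_loop_diff disk_loop_ident B adj dFp_dz_disk[OF z] Fp_disk[OF z])
  then show ?thesis by (rule disk_loop_cong) (simp add: eq)
qed

lemma cnj_circle: "t \<in> T \<Longrightarrow> cnj t = inverse t"
  using complex_norm_square[of t] by (auto intro!: inverse_unique[symmetric])

lemma Fm_cnj_disk: "z \<in> A \<Longrightarrow> disk_loop (\<lambda>t. Fm z (cnj t) $ i $ j)"
  using Fm_disk[of z i j] unfolding disk_loop_def by blast

text \<open>The inverted loop \<open>F\<^sub>- - I\<close> vanishes at the origin, and this for all \<open>z\<close>; so it may be divided by \<open>t\<close> before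
  it is differentiated.\<close>

lemma dFm_dz_cnj_disk: "z \<in> A \<Longrightarrow> disk_loop (\<lambda>t. dFm_dz z (cnj t) $ i $ j / t)"
proof (rule disk_loop_dz[where K = "\<lambda>z t. (Fm z (cnj t) $ i $ j - (mat 1 :: cmat2) $ i $ j) / t" and A = A
      and b = "\<lambda>_ _. 0"])
  fix z t assume z: "z \<in> A" and t: "t \<in> T"
  have "has_dz (\<lambda>\<zeta>. Fm \<zeta> (cnj t) $ i $ j) (dFm_dz z (cnj t) $ i $ j) 0 z"
    using has_dz_deriv_param[of A T "\<lambda>\<zeta> t. Fm \<zeta> t $ i $ j" z "cnj t"] z t open_A Fm_holo
    by (simp add: dFm_dz_def)
  from has_dz_cmult[OF has_dz_diff[OF this has_dz_const], of "inverse t"]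
  show "has_dz (\<lambda>z. (Fm z (cnj t) $ i $ j - (mat 1 :: cmat2) $ i $ j) / t) (dFm_dz z (cnj t) $ i $ j / t) 0 z"
    by (simp add: divide_inverse mult.commute)
next
  have "continuous_on (A \<times> T) (\<lambda>p. dFm_dz (fst p) (cnj (snd p)) $ i $ j)"
    using cont_dFm_dz unfolding cont_loops_def case_prod_unfold
    by (intro continuous_on_compose2[of "A \<times> T" "\<lambda>p. dFm_dz (fst p) (snd p) $ i $ j" _ "\<lambda>p. (fst p, cnj (snd p))", simplified])
      (auto intro!: continuous_intros)
  then show "continuous_on (A \<times> T) (\<lambda>(z, t). dFm_dz z (cnj t) $ i $ j / t)"
    unfolding case_prod_unfold by (auto intro!: continuous_intros)
next
  fix z assume z: "z \<in> A"
  obtain G where G: "continuous_on (cball 0 1) G" "G holomorphic_on ball 0 1"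
    "\<forall>t\<in>T. G t = Fm z (cnj t) $ i $ j" "G 0 = (mat 1 :: cmat2) $ i $ j"
    using Fm_disk[OF z] by blast
  have "disk_loop (\<lambda>t. (\<lambda>t. G t - (mat 1 :: cmat2) $ i $ j) t / t)"
    by (rule disk_loop_divide_ident) (use G in \<open>auto intro!: continuous_intros holomorphic_intros\<close>)
  then show "disk_loop (\<lambda>t. (Fm z (cnj t) $ i $ j - (mat 1 :: cmat2) $ i $ j) / t)"
    by (rule disk_loop_cong) (use G in auto)
qed (use open_A in auto)

text \<open>On the circle \<open>cnj t = 1/t\<close>, so the factor \<open>\<theta>\<close> in \<open>P = \<theta> F\<^sub>-\<inverse> \<partial>\<^sub>z F\<^sub>-\<close> becomes the divisor \<open>t\<close> that
  the derivative of the inverted loop absorbs.\<close>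

lemma P_cnj_disk: "z \<in> A \<Longrightarrow> disk_loop (\<lambda>t. P z (cnj t) $ i $ j)"
proof -
  assume z: "z \<in> A"
  have adj: "disk_loop (\<lambda>t. adjugate2 (Fm z (cnj t)) $ i $ j)" for i j
  proof -
    have "\<forall>i j. disk_loop (\<lambda>t. adjugate2 (Fm z (cnj t)) $ i $ j)"
      unfolding forall_2 adjugate2_def using Fm_cnj_disk[OF z] by (auto intro: disk_loop_uminus)
    then show ?thesis by blast
  qed
  have "disk_loop (\<lambda>t. adjugate2 (Fm z (cnj t)) $ i $ 1 * (dFm_dz z (cnj t) $ 1 $ j / t)
      + adjugate2 (Fm z (cnj t)) $ i $ 2 * (dFm_dz z (cnj t) $ 2 $ j / t))"
    by (intro disk_loop_add disk_loop_mult adj dFm_dz_cnj_disk[OF z])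
  then show ?thesis
  proof (rule disk_loop_cong)
    fix t assume t: "t \<in> T"
    then have ct: "cnj t \<in> T" by simp
    show "adjugate2 (Fm z (cnj t)) $ i $ 1 * (dFm_dz z (cnj t) $ 1 $ j / t)
      + adjugate2 (Fm z (cnj t)) $ i $ 2 * (dFm_dz z (cnj t) $ 2 $ j / t) = P z (cnj t) $ i $ j"
      by (subst P_eq_dlog_Fm[OF ct], subst dlog_Fm_eq[OF z ct])
        (simp add: matrix_mult_nth2 cnj_circle[OF t] divide_inverse algebra_simps)
  qed
qed

lemma P_const:
  assumes z: "z \<in> A" and t: "t \<in> T"
  shows "P z t = P z 1"
proof -
  have "P z t $ i $ j = P z 1 $ i $ j" for i j
  proof -
    obtain G where G: "continuous_on (cball 0 1) G" "G holomorphic_on ball 0 1" "\<forall>t\<in>T. G t = P z t $ i $ j"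
      using P_disk[OF z] unfolding disk_loop_def by blast
    obtain M where M: "continuous_on (cball 0 1) M" "M holomorphic_on ball 0 1" "\<forall>t\<in>T. M t = P z (cnj t) $ i $ j"
      using P_cnj_disk[OF z] unfolding disk_loop_def by blast
    have "G w = G 0" if "w \<in> cball 0 1" for w
      by (rule disk_loop_reflect_const[OF G(1,2) M(1,2) _ that]) (use G M in auto)
    then have "G t = G 1" using t by (metis mem_cball_0 mem_sphere_0 norm_one order_refl)
    then show ?thesis using G t by simp
  qed
  then show ?thesis by (simp add: vec_eq_iff)
qed

text \<open>If the product is \<open>I\<close>, the factors are inverse to each other, so each of them extends to both sides of the
  circle and is constant; the normalization at infinity determines the constant.\<close>

lemma Fp_at_identity:
  assumes z: "z \<in> A" and F: "\<And>t. t \<in> T \<Longrightarrow> F z t = mat 1" and t: "t \<in> T"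
  shows "Fp z t = mat 1"
proof -
  have Fm_adj: "Fm z t = adjugate2 (Fp z t)" if t: "t \<in> T" for t
  proof -
    have "Fm z t ** (Fp z t ** adjugate2 (Fp z t)) = mat 1 ** adjugate2 (Fp z t)"
      using F_eq[OF z t] F[OF t] by (simp add: matrix_mul_assoc)
    then show ?thesis using adjugate2_mult[OF detp[OF z t]] by simp
  qed
  have "Fm z t $ i $ j = (mat 1 :: cmat2) $ i $ j" for i j
  proof -
    have "\<forall>i j. disk_loop (\<lambda>t. adjugate2 (Fp z t) $ i $ j)"
      unfolding forall_2 adjugate2_def using Fp_disk[OF z] by (auto intro: disk_loop_uminus)
    then have "disk_loop (\<lambda>t. Fm z t $ i $ j)"
      by (metis (no_types, lifting) Fm_adj disk_loop_cong)
    then obtain G where G: "continuous_on (cball 0 1) G" "G holomorphic_on ball 0 1" "\<forall>t\<in>T. G t = Fm z t $ i $ j"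
      unfolding disk_loop_def by blast
    obtain M where M: "continuous_on (cball 0 1) M" "M holomorphic_on ball 0 1" "\<forall>t\<in>T. M t = Fm z (cnj t) $ i $ j"
      "M 0 = (mat 1 :: cmat2) $ i $ j"
      using Fm_disk[OF z] by blast
    have "M (cnj t) = M 0"
      by (rule disk_loop_reflect_const[OF M(1,2) G(1,2)]) (use G M t in auto)
    then show ?thesis using M t by simp
  qed
  then have "Fm z t = mat 1" by (simp add: vec_eq_iff)
  then show ?thesis using F_eq[OF z t] F[OF t] by simp
qed

definition Fp_coeff :: "nat \<Rightarrow> complex \<Rightarrow> cmat2" where
  "Fp_coeff k z = (\<chi> i j. loop_coeff k (\<lambda>t. Fp z t $ i $ j))"

lemma Fp_coeff_nth [simp]: "Fp_coeff k z $ i $ j = loop_coeff k (\<lambda>t. Fp z t $ i $ j)"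
  by (simp add: Fp_coeff_def)

lemma has_dz_Fp_coeff:
  assumes "z \<in> A"
  shows "has_dz (\<lambda>z. Fp_coeff k z $ i $ j) (loop_coeff k (\<lambda>t. dFp_dz z t $ i $ j))
    (loop_coeff k (\<lambda>t. (Fp z t ** Omega_zb z t) $ i $ j)) z"
  unfolding Fp_coeff_nth
proof (rule loop_coeff_has_dz[OF open_A assms has_dz_Fp])
  show "continuous_on (A \<times> T) (\<lambda>(z,t). dFp_dz z t $ i $ j)"
    using cont_dFp_dz by (simp add: cont_loops_def)
  show "continuous_on (A \<times> T) (\<lambda>(z,t). (Fp z t ** Omega_zb z t) $ i $ j)"
    using cont_loops_mult[OF cont_Fp cont_Omega(2)] by (simp add: cont_loops_def)
qed (simp_all add: cont_loops_slice[OF cont_Fp])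

lemma dlog_Fm_const: "z \<in> A \<Longrightarrow> t \<in> T \<Longrightarrow> dlog_Fm z t = cscale (inverse t) (P z 1)"
  using P_const[of z t] by (simp only: dlog_Fm_def)

lemma coeff_dFp_1:
  assumes z: "z \<in> A"
  shows "loop_coeff k (\<lambda>t. dFp_dz z t $ i $ 1) =
    (- ux z / 2) * Fp_coeff k z $ i $ 1 + (of_real (exp (u z)) / 2 * s) * Fp_coeff (Suc k) z $ i $ 2
      - (P z 1 $ i $ 1 * Fp_coeff (Suc k) z $ 1 $ 1 + P z 1 $ i $ 2 * Fp_coeff (Suc k) z $ 2 $ 1)"
proof -
  note c = cont_loops_slice[OF cont_Fp z]
  have "loop_coeff k (\<lambda>t. dFp_dz z t $ i $ 1) = loop_coeff k (\<lambda>t. (- ux z / 2) * Fp z t $ i $ 1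
      + (of_real (exp (u z)) / 2 * s) * (Fp z t $ i $ 2 / t)
      - (P z 1 $ i $ 1 * (Fp z t $ 1 $ 1 / t) + P z 1 $ i $ 2 * (Fp z t $ 2 $ 1 / t)))"
    by (rule loop_coeff_cong)
      (simp only: dFp_dz_def vector_minus_component matrix_mult_nth2 Omega_z_def mat2_nth dlog_Fm_const[OF z] cscale_nth
        divide_inverse algebra_simps mult_minus_left mult_minus_right)
  also have "\<dots> = (- ux z / 2) * Fp_coeff k z $ i $ 1 + (of_real (exp (u z)) / 2 * s) * Fp_coeff (Suc k) z $ i $ 2
      - (P z 1 $ i $ 1 * Fp_coeff (Suc k) z $ 1 $ 1 + P z 1 $ i $ 2 * Fp_coeff (Suc k) z $ 2 $ 1)"
    unfolding Fp_coeff_nth by (rule loop_coeff_combination[OF c c c c])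
  finally show ?thesis .
qed

lemma coeff_dFp_2:
  assumes z: "z \<in> A"
  shows "loop_coeff k (\<lambda>t. dFp_dz z t $ i $ 2) =
    (ux z / 2) * Fp_coeff k z $ i $ 2 + (- of_real (exp (- u z)) * Q z) * Fp_coeff (Suc k) z $ i $ 1
      - (P z 1 $ i $ 1 * Fp_coeff (Suc k) z $ 1 $ 2 + P z 1 $ i $ 2 * Fp_coeff (Suc k) z $ 2 $ 2)"
proof -
  note c = cont_loops_slice[OF cont_Fp z]
  have "loop_coeff k (\<lambda>t. dFp_dz z t $ i $ 2) = loop_coeff k (\<lambda>t. (ux z / 2) * Fp z t $ i $ 2
      + (- of_real (exp (- u z)) * Q z) * (Fp z t $ i $ 1 / t)
      - (P z 1 $ i $ 1 * (Fp z t $ 1 $ 2 / t) + P z 1 $ i $ 2 * (Fp z t $ 2 $ 2 / t)))"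
    by (rule loop_coeff_cong)
      (simp only: dFp_dz_def vector_minus_component matrix_mult_nth2 Omega_z_def mat2_nth dlog_Fm_const[OF z] cscale_nth
        divide_inverse algebra_simps mult_minus_left mult_minus_right)
  also have "\<dots> = (ux z / 2) * Fp_coeff k z $ i $ 2 + (- of_real (exp (- u z)) * Q z) * Fp_coeff (Suc k) z $ i $ 1
      - (P z 1 $ i $ 1 * Fp_coeff (Suc k) z $ 1 $ 2 + P z 1 $ i $ 2 * Fp_coeff (Suc k) z $ 2 $ 2)"
    unfolding Fp_coeff_nth by (rule loop_coeff_combination[OF c c c c])
  finally show ?thesis .
qed

text \<open>The identities satisfied by \<open>F\<^sub>+\<close> on the circle (its off-diagonal entries are odd, its determinant is 1)
  persist for the extension, by the maximum principle, and are read off at the origin.\<close>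

lemma Fp_coeff_1:
  assumes z: "z \<in> A"
  shows "Fp_coeff 1 z $ 1 $ 2 = 0" "Fp_coeff 1 z $ 2 $ 1 = 0" "Fp_coeff 1 z $ 1 $ 1 * Fp_coeff 1 z $ 2 $ 2 = 1"
proof -
  have "\<exists>G. continuous_on (cball 0 1) G \<and> G holomorphic_on ball 0 1 \<and> (\<forall>t\<in>T. G t = Fp z t $ i $ j)" for i j
    using Fp_disk[OF z] unfolding disk_loop_def by blast
  then obtain G where G: "\<And>i j. continuous_on (cball 0 1) (G i j)" "\<And>i j. G i j holomorphic_on ball 0 1"
    "\<And>i j t. t \<in> T \<Longrightarrow> G i j t = Fp z t $ i $ j" by metis
  have y1: "Fp_coeff 1 z $ i $ j = G i j 0" for i j
    using loop_coeff_Suc_0[OF G(1,2), of i j "\<lambda>t. Fp z t $ i $ j"] G(3) by simp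
  have c': "continuous_on (cball 0 1) (\<lambda>t. G i j (- t))" for i j
    by (rule continuous_on_compose2[OF G(1)]) (auto intro: continuous_intros)
  have h': "(\<lambda>t. G i j (- t)) holomorphic_on ball 0 1" for i j
  proof -
    have "(\<lambda>t::complex. - t) holomorphic_on ball 0 1" "(\<lambda>t. - t) ` ball 0 1 \<subseteq> (ball 0 1 :: complex set)"
      by (auto intro: holomorphic_intros)
    from holomorphic_on_compose_gen[OF this(1) G(2) this(2)] show ?thesis by (simp add: comp_def)
  qed
  have odd: "G i j 0 = 0" if "\<And>t. t \<in> T \<Longrightarrow> Fp z (- t) $ i $ j = - Fp z t $ i $ j" for i j
  proof -
    have "norm (G i j 0 + G i j (- 0)) \<le> 0"
      by (rule max_modulus_disk[of "\<lambda>t. G i j t + G i j (- t)"])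
        (use that G(3) in \<open>auto intro!: continuous_intros holomorphic_intros G c' h'\<close>)
    then show ?thesis by simp
  qed
  show "Fp_coeff 1 z $ 1 $ 2 = 0" "Fp_coeff 1 z $ 2 $ 1 = 0"
    unfolding y1 using twist[OF z] by (auto intro!: odd)
  have "norm (G 1 1 0 * G 2 2 0 - G 1 2 0 * G 2 1 0 - 1) \<le> 0"
    by (rule max_modulus_disk[of "\<lambda>t. G 1 1 t * G 2 2 t - G 1 2 t * G 2 1 t - 1"])
      (use detp[OF z] G(3) in \<open>auto intro!: continuous_intros holomorphic_intros G simp: det_2\<close>)
  then show "Fp_coeff 1 z $ 1 $ 1 * Fp_coeff 1 z $ 2 $ 2 = 1"
    using \<open>Fp_coeff 1 z $ 1 $ 2 = 0\<close> unfolding y1 by simp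
qed

text \<open>The function \<open>p = e\<^sup>u/\<alpha>\<^sup>2\<close>, defined through \<open>P\<close> so that it is visibly meromorphic.\<close>

definition factor :: "complex \<Rightarrow> complex" where "factor z = 2 * P z 1 $ 2 $ 1 / s"

text \<open>The recursion for \<open>k = 0\<close>, that is, for the coefficient of \<open>\<theta>\<inverse>\<close>: its left-hand side vanishes because
  \<open>F\<^sub>+\<close> and its derivative extend to the disk.\<close>

lemma P_entries:
  assumes z: "z \<in> A"
  shows "P z 1 $ 1 $ 1 = 0" "P z 1 $ 2 $ 2 = 0"
    "factor z = of_real (exp (u z)) * (Fp_coeff 1 z $ 2 $ 2)\<^sup>2"
    "P z 1 $ 1 $ 2 = - of_real (exp (- u z)) * Q z * (Fp_coeff 1 z $ 1 $ 1)\<^sup>2"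
proof -
  have y0: "Fp_coeff 0 z $ i $ j = 0" for i j
    unfolding Fp_coeff_nth by (rule loop_coeff_0[OF Fp_disk[OF z]])
  define \<alpha> \<beta> where "\<alpha> = Fp_coeff 1 z $ 1 $ 1" and "\<beta> = Fp_coeff 1 z $ 2 $ 2"
  note y1 = Fp_coeff_1[OF z, folded \<alpha>_def \<beta>_def]
  have nz: "\<alpha> \<noteq> 0" "\<beta> \<noteq> 0" using y1(3) by auto
  have e1: "of_real (exp (u z)) / 2 * s * Fp_coeff 1 z $ i $ 2 - (P z 1 $ i $ 1 * \<alpha> + P z 1 $ i $ 2 * Fp_coeff 1 z $ 2 $ 1) = 0" for i
    using coeff_dFp_1[OF z, of 0 i] loop_coeff_0[OF dFp_dz_disk[OF z]] y0 unfolding \<alpha>_def One_nat_def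
    by (simp del: Fp_coeff_nth)
  have e2: "- of_real (exp (- u z)) * Q z * Fp_coeff 1 z $ i $ 1 - (P z 1 $ i $ 1 * Fp_coeff 1 z $ 1 $ 2 + P z 1 $ i $ 2 * \<beta>) = 0" for i
    using coeff_dFp_2[OF z, of 0 i] loop_coeff_0[OF dFp_dz_disk[OF z]] y0 unfolding \<beta>_def One_nat_def
    by (simp del: Fp_coeff_nth)
  show "P z 1 $ 1 $ 1 = 0" using e1[of 1] nz y1 by (simp del: Fp_coeff_nth)
  show "P z 1 $ 2 $ 2 = 0" using e2[of 2] nz y1 by (simp del: Fp_coeff_nth)
  have "P z 1 $ 2 $ 1 * \<alpha> = of_real (exp (u z)) / 2 * s * \<beta>"
    using e1[of 2] y1 by (simp add: \<beta>_def del: Fp_coeff_nth)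
  then have "P z 1 $ 2 $ 1 * (\<alpha> * \<beta>) = of_real (exp (u z)) / 2 * s * \<beta>\<^sup>2"
    by (simp add: power2_eq_square mult.assoc[symmetric])
  then show "factor z = of_real (exp (u z)) * (Fp_coeff 1 z $ 2 $ 2)\<^sup>2"
    using s y1(3) unfolding factor_def \<beta>_def[symmetric] by (simp add: field_simps del: Fp_coeff_nth)
  have "P z 1 $ 1 $ 2 * \<beta> = - of_real (exp (- u z)) * Q z * \<alpha>"
    using e2[of 1] y1 by (simp add: \<alpha>_def del: Fp_coeff_nth)
  then have "P z 1 $ 1 $ 2 * (\<alpha> * \<beta>) = - of_real (exp (- u z)) * Q z * \<alpha>\<^sup>2"
    by (simp add: power2_eq_square mult_ac)
  then show "P z 1 $ 1 $ 2 = - of_real (exp (- u z)) * Q z * (Fp_coeff 1 z $ 1 $ 1)\<^sup>2"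
    using y1(3) unfolding \<alpha>_def[symmetric] by (simp del: Fp_coeff_nth)
qed

lemma factor_nonzero: "z \<in> A \<Longrightarrow> factor z \<noteq> 0"
  using P_entries(3)[of z] Fp_coeff_1(3)[of z] by (auto simp del: Fp_coeff_nth)

text \<open>With \<open>P\<close> holomorphic, this makes \<open>Q\<close> holomorphic, as required for the coefficients of the recursion.\<close>

lemma Q_eq:
  assumes z: "z \<in> A"
  shows "Q z = - P z 1 $ 1 $ 2 * factor z"
proof -
  have "- P z 1 $ 1 $ 2 * factor z = (of_real (exp (- u z)) * of_real (exp (u z))) * Q z
      * (Fp_coeff 1 z $ 1 $ 1 * Fp_coeff 1 z $ 2 $ 2)\<^sup>2"
    unfolding P_entries[OF z] by (simp add: power_mult_distrib mult_ac del: Fp_coeff_nth)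
  also have "of_real (exp (- u z)) * of_real (exp (u z)) = (1::complex)"
    by (simp flip: of_real_mult exp_add)
  finally show ?thesis using Fp_coeff_1(3)[OF z] by simp
qed

lemma P_eq:
  assumes "z \<in> A" "t \<in> T"
  shows "P z t = mat2 0 (- Q z / factor z) (factor z / 2 * s) 0"
  using P_entries(1,2)[OF assms(1)] Q_eq[OF assms(1)] factor_nonzero[OF assms(1)] s
  unfolding P_const[OF assms] by (simp add: cmat2_eq_iff) (simp add: factor_def)

lemma P_holo: "(\<lambda>z. P z 1 $ i $ j) holomorphic_on A"
proof -
  have a: "(\<lambda>z. adjugate2 (Fm z 1) $ i $ j) holomorphic_on A" for i j
  proof -
    have "\<forall>i j. (\<lambda>z. adjugate2 (Fm z 1) $ i $ j) holomorphic_on A"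
      unfolding forall_2 adjugate2_def mat2_nth
      by (intro conjI holomorphic_intros Fm_holo) simp_all
    then show ?thesis by blast
  qed
  have d: "(\<lambda>z. dFm_dz z 1 $ i $ j) holomorphic_on A" for i j
    unfolding dFm_dz_def vec_lambda_beta by (rule holomorphic_deriv[OF Fm_holo open_A]) simp
  have "(\<lambda>z. (adjugate2 (Fm z 1) ** dFm_dz z 1) $ i $ j) holomorphic_on A"
    unfolding matrix_mult_nth2 by (intro holomorphic_intros a d)
  then show ?thesis
    by (rule holomorphic_transform) (use dlog_Fm_eq[of _ 1] P_eq_dlog_Fm[of 1] in \<open>simp add: matrix_mult_nth2\<close>)
qed

lemma factor_holo: "factor holomorphic_on A"
  unfolding factor_def using s by (intro holomorphic_intros P_holo)

lemma Q_holo: "Q holomorphic_on A"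
  by (rule holomorphic_transform[of "\<lambda>z. - P z 1 $ 1 $ 2 * factor z"])
    (auto intro!: holomorphic_intros P_holo factor_holo simp: Q_eq)

text \<open>The two columns of \<open>F\<^sub>+ diag(e\<^bsup>u/2\<^esup>, e\<^bsup>-u/2\<^esup>)\<close>, coefficient by coefficient.\<close>

definition "gauged1 k i z = exp (of_real (u z) / 2) * Fp_coeff k z $ i $ 1"
definition "gauged2 k i z = exp (- of_real (u z) / 2) * Fp_coeff k z $ i $ 2"

text \<open>The derivative of the gauge factor cancels the diagonal term, so that \<open>\<partial>\<^sub>z\<close> only involves coefficients of
  the next higher index.\<close>

lemma has_dz_gauged1:
  assumes z: "z \<in> A"
  shows "\<exists>b. has_dz (gauged1 k i) (s / 2 * exp (2 * of_real (u z)) * gauged2 (Suc k) i z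
    - (P z 1 $ i $ 1 * gauged1 (Suc k) 1 z + P z 1 $ i $ 2 * gauged1 (Suc k) 2 z)) b z"
proof -
  let ?e = "exp (complex_of_real (u z) / 2)"
  have d: "has_dz (\<lambda>z. exp (of_real (u z) / 2)) (?e / 2 * ux z) (?e / 2 * uy z) z"
    by (rule has_dz_chain[OF du[OF z], where g = "\<lambda>x. exp (x / 2)"]) (auto intro!: derivative_eq_intros)
  have "?e * of_real (exp (u z)) = exp (2 * of_real (u z)) * exp (- of_real (u z) / 2 :: complex)"
    by (simp flip: exp_of_real exp_add)
  then have "?e / 2 * ux z * Fp_coeff k z $ i $ 1 + ?e * loop_coeff k (\<lambda>t. dFp_dz z t $ i $ 1)
     = s / 2 * exp (2 * of_real (u z)) * gauged2 (Suc k) i z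
    - (P z 1 $ i $ 1 * gauged1 (Suc k) 1 z + P z 1 $ i $ 2 * gauged1 (Suc k) 2 z)"
    unfolding coeff_dFp_1[OF z] gauged1_def gauged2_def
    by (simp add: algebra_simps del: Fp_coeff_nth)
  then show ?thesis
    using has_dz_mult[OF d has_dz_Fp_coeff[OF z, of k i 1]] unfolding gauged1_def by (metis (no_types, lifting))
qed

lemma has_dz_gauged2:
  assumes z: "z \<in> A"
  shows "\<exists>b. has_dz (gauged2 k i) (- Q z * exp (- 2 * of_real (u z)) * gauged1 (Suc k) i z
    - (P z 1 $ i $ 1 * gauged2 (Suc k) 1 z + P z 1 $ i $ 2 * gauged2 (Suc k) 2 z)) b z"
proof -
  let ?e = "exp (- complex_of_real (u z) / 2)"
  have d: "has_dz (\<lambda>z. exp (- of_real (u z) / 2)) (- ?e / 2 * ux z) (- ?e / 2 * uy z) z"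
    by (rule has_dz_chain[OF du[OF z], where g = "\<lambda>x. exp (- x / 2)"]) (auto intro!: derivative_eq_intros)
  have "?e * of_real (exp (- u z)) = exp (- 2 * of_real (u z)) * exp (of_real (u z) / 2 :: complex)"
    by (simp flip: exp_of_real exp_add)
  then have "- ?e / 2 * ux z * Fp_coeff k z $ i $ 2 + ?e * loop_coeff k (\<lambda>t. dFp_dz z t $ i $ 2)
     = - Q z * exp (- 2 * of_real (u z)) * gauged1 (Suc k) i z
    - (P z 1 $ i $ 1 * gauged2 (Suc k) 1 z + P z 1 $ i $ 2 * gauged2 (Suc k) 2 z)"
    unfolding coeff_dFp_2[OF z] gauged1_def gauged2_def
    by (simp add: algebra_simps del: Fp_coeff_nth)
  then show ?thesis
    using has_dz_mult[OF d has_dz_Fp_coeff[OF z, of k i 2]] unfolding gauged2_def by (metis (no_types, lifting))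
qed

lemma factor_gauge_relation:
  assumes z: "z \<in> A"
  shows "factor z * gauged1 1 1 z = exp (2 * of_real (u z)) * gauged2 1 2 z"
proof -
  have "exp (of_real (u z)) * exp (of_real (u z) / 2) = exp (2 * of_real (u z)) * exp (- of_real (u z) / 2 :: complex)"
    by (simp flip: exp_add)
  then have "factor z * gauged1 1 1 z = (Fp_coeff 1 z $ 1 $ 1 * Fp_coeff 1 z $ 2 $ 2) * (exp (2 * of_real (u z)) * gauged2 1 2 z)"
    unfolding P_entries[OF z] gauged1_def gauged2_def exp_of_real[symmetric]
    by (simp add: power2_eq_square mult_ac del: Fp_coeff_nth)
  then show ?thesis using Fp_coeff_1(3)[OF z] by simp
qed

text \<open>The comparison of jets. By induction on the order, the recursion makes all coefficients of positive
  powers of \<open>\<theta>\<close> flat at \<open>0\<close>, since they vanish at \<open>0\<close>; one more application makes the coefficients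
  of \<open>\<theta>\<^sup>0\<close> flat up to their values at \<open>0\<close>.\<close>

theorem factor_eq_holomorphic_part:
  assumes F0: "\<And>t. t \<in> T \<Longrightarrow> F 0 t = mat 1"
    and r: "0 < r" "ball 0 r \<subseteq> A"
    and U: "sep_holo r U" "\<And>z. z \<in> ball 0 r \<Longrightarrow> U z (cnj z) = of_real (u z)"
    and z: "z \<in> ball 0 r"
  shows "exp (2 * U z 0) = exp (of_real (u 0)) * factor z"
proof -
  let ?W = "ball 0 r :: complex set"
  have A0: "0 \<in> A" using r by auto
  have ball: "x \<in> A" if "x \<in> ?W" for x using that r by auto
  have y_0: "Fp_coeff (Suc k) 0 = (if k = 0 then mat 1 else 0)" for k
  proof -
    have "loop_coeff (Suc k) (\<lambda>t. Fp 0 t $ i $ j) = loop_coeff (Suc k) (\<lambda>_. (mat 1 :: cmat2) $ i $ j)" for i j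
      by (rule loop_coeff_cong) (subst Fp_at_identity[OF A0 F0], auto)
    then show ?thesis by (simp add: vec_eq_iff loop_coeff_const)
  qed
  have hP: "sep_holo r (\<lambda>z w. P z 1 $ i $ j)" for i j
    by (intro sep_holo_fst holomorphic_on_subset[OF P_holo r(2)])
  have hQ: "sep_holo r (\<lambda>z w. - Q z)"
    by (intro sep_holo_fst holomorphic_on_minus holomorphic_on_subset[OF Q_holo r(2)])
  have step1: "zflat ?W n (\<lambda>z. s / 2 * exp (2 * of_real (u z)) * gauged2 k i z
      - (P z 1 $ i $ 1 * gauged1 k 1 z + P z 1 $ i $ 2 * gauged1 k 2 z))"
    if "\<And>i. zflat ?W n (gauged1 k i)" "\<And>i. zflat ?W n (gauged2 k i)" for n k i
  proof (rule zflat_cong)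
    show "zflat ?W n (\<lambda>z. s / 2 * exp (2 * U z (cnj z)) * gauged2 k i z
      - (P z 1 $ i $ 1 * gauged1 k 1 z + P z 1 $ i $ 2 * gauged1 k 2 z))"
      by (intro zflat_diff zflat_add zflat_mult_diag[OF hP]
          zflat_mult_diag[OF sep_holo_mult[OF sep_holo_fst sep_holo_exp[OF U(1)]]] that holomorphic_intros)
  qed (use U r in auto)
  have step2: "zflat ?W n (\<lambda>z. - Q z * exp (- 2 * of_real (u z)) * gauged1 k i z
      - (P z 1 $ i $ 1 * gauged2 k 1 z + P z 1 $ i $ 2 * gauged2 k 2 z))"
    if "\<And>i. zflat ?W n (gauged1 k i)" "\<And>i. zflat ?W n (gauged2 k i)" for n k i
  proof (rule zflat_cong)
    show "zflat ?W n (\<lambda>z. - Q z * exp (- 2 * U z (cnj z)) * gauged1 k i z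
      - (P z 1 $ i $ 1 * gauged2 k 1 z + P z 1 $ i $ 2 * gauged2 k 2 z))"
      by (intro zflat_diff zflat_add zflat_mult_diag[OF hP]
          zflat_mult_diag[OF sep_holo_mult[OF hQ sep_holo_exp[OF U(1)]]] that)
  qed (use U r in auto)
  have "\<exists>b. \<forall>z\<in>A. has_dz (gauged1 k i) (s / 2 * exp (2 * of_real (u z)) * gauged2 (Suc k) i z
      - (P z 1 $ i $ 1 * gauged1 (Suc k) 1 z + P z 1 $ i $ 2 * gauged1 (Suc k) 2 z)) (b z) z" for k i
    by (rule bchoice) (use has_dz_gauged1 in blast)
  then obtain b1 where b1: "\<And>k i z. z \<in> A \<Longrightarrow> has_dz (gauged1 k i) (s / 2 * exp (2 * of_real (u z)) * gauged2 (Suc k) i z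
      - (P z 1 $ i $ 1 * gauged1 (Suc k) 1 z + P z 1 $ i $ 2 * gauged1 (Suc k) 2 z)) (b1 k i z) z"
    by metis
  have "\<exists>b. \<forall>z\<in>A. has_dz (gauged2 k i) (- Q z * exp (- 2 * of_real (u z)) * gauged1 (Suc k) i z
      - (P z 1 $ i $ 1 * gauged2 (Suc k) 1 z + P z 1 $ i $ 2 * gauged2 (Suc k) 2 z)) (b z) z" for k i
    by (rule bchoice) (use has_dz_gauged2 in blast)
  then obtain b2 where b2: "\<And>k i z. z \<in> A \<Longrightarrow> has_dz (gauged2 k i) (- Q z * exp (- 2 * of_real (u z)) * gauged1 (Suc k) i z
      - (P z 1 $ i $ 1 * gauged2 (Suc k) 1 z + P z 1 $ i $ 2 * gauged2 (Suc k) 2 z)) (b2 k i z) z"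
    by metis
  have z0: "gauged1 (Suc (Suc k)) i 0 = 0" "gauged2 (Suc (Suc k)) i 0 = 0" for k i
    by (simp_all add: gauged1_def gauged2_def y_0 del: Fp_coeff_nth)
  have flat: "zflat ?W n (gauged1 (Suc (Suc k)) i) \<and> zflat ?W n (gauged2 (Suc (Suc k)) i)" for n k i
  proof (induction n arbitrary: k i)
    case 0
    show ?case using z0 by simp
  next
    case (Suc n)
    have "zflat ?W (Suc n) (gauged1 (Suc (Suc k)) i)"
      by (rule zflat_SucI[OF z0(1) b1[OF ball] step1]) (use Suc.IH in auto)
    moreover have "zflat ?W (Suc n) (gauged2 (Suc (Suc k)) i)"
      by (rule zflat_SucI[OF z0(2) b2[OF ball] step2]) (use Suc.IH in auto)
    ultimately show ?case ..
  qed
  define c where "c = exp (complex_of_real (u 0) / 2)"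
  have c: "c * inverse c = 1" "c * c = exp (of_real (u 0))"
    unfolding c_def by (simp_all flip: exp_add)
  have at0: "gauged1 1 1 0 - c = 0" "gauged2 1 2 0 - inverse c = 0"
    using y_0[of 0] by (simp_all add: gauged1_def gauged2_def c_def exp_minus del: Fp_coeff_nth)
  have flat1: "zflat ?W n (\<lambda>z. gauged1 1 1 z - c)" for n
  proof (cases n)
    case 0
    then show ?thesis using at0 by simp
  next
    case (Suc m)
    show ?thesis unfolding Suc
    proof (rule zflat_SucI[where \<phi> = "\<lambda>z. gauged1 1 1 z - c", OF at0(1) _ step1])
      show "zflat ?W m (gauged1 (Suc 1) i)" "zflat ?W m (gauged2 (Suc 1) i)" for i using flat[of m 0] by simp_all
    qed (use has_dz_diff[OF b1[OF ball] has_dz_const] in simp)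
  qed
  have flat2: "zflat ?W n (\<lambda>z. gauged2 1 2 z - inverse c)" for n
  proof (cases n)
    case 0
    then show ?thesis using at0 by simp
  next
    case (Suc m)
    show ?thesis unfolding Suc
    proof (rule zflat_SucI[where \<phi> = "\<lambda>z. gauged2 1 2 z - inverse c", OF at0(2) _ step2])
      show "zflat ?W m (gauged1 (Suc 1) i)" "zflat ?W m (gauged2 (Suc 1) i)" for i using flat[of m 0] by simp_all
    qed (use has_dz_diff[OF b2[OF ball] has_dz_const] in simp)
  qed
  have hp: "sep_holo r (\<lambda>z w. factor z)"
    by (intro sep_holo_fst holomorphic_on_subset[OF factor_holo r(2)])
  have hU0: "(\<lambda>z. exp (2 * U z 0)) holomorphic_on ?W"
    using U(1) r unfolding sep_holo_def by (auto intro!: holomorphic_intros)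
  let ?f = "\<lambda>z. exp (2 * U z 0) - exp (of_real (u 0)) * factor z"
  have "zflat ?W n ?f" for n
  proof (rule zflat_cong)
    \<comment> \<open>The relation between \<open>gauged1\<close> and \<open>gauged2\<close> with both replaced by their deviations from the values
      \<open>c\<close> and \<open>1/c\<close> at \<open>0\<close>; what is left over after multiplication by \<open>c\<close> is \<open>e\<^sup>2\<^sup>u - e\<^bsup>u(0)\<^esup> p\<close>.\<close>
    show "zflat ?W n (\<lambda>z. c * (factor z * (gauged1 1 1 z - c) - exp (2 * U z (cnj z)) * (gauged2 1 2 z - inverse c))
        - (exp (2 * U z (cnj z)) - exp (2 * U z 0)))"
      using r by (intro zflat_diff[OF zflat_cmult[OF zflat_diff]] zflat_mult_diag[OF hp flat1]
          zflat_mult_diag[OF sep_holo_exp[OF U(1)] flat2]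
          zflat_diag[of r "\<lambda>z w. exp (2 * U z w) - exp (2 * U z 0)"]
          sep_holo_diff sep_holo_exp U(1) sep_holo_fst[OF hU0]) auto
    fix z assume z: "z \<in> ?W"
    have "c * (factor z * (gauged1 1 1 z - c) - exp (2 * U z (cnj z)) * (gauged2 1 2 z - inverse c))
      = c * (factor z * gauged1 1 1 z - exp (2 * U z (cnj z)) * gauged2 1 2 z) - (c * c) * factor z + (c * inverse c) * exp (2 * U z (cnj z))"
      by (simp only: algebra_simps)
    also have "\<dots> = - exp (of_real (u 0)) * factor z + exp (2 * U z (cnj z))"
      using factor_gauge_relation[OF ball[OF z]] unfolding c U(2)[OF z] by simp
    finally show "c * (factor z * (gauged1 1 1 z - c) - exp (2 * U z (cnj z)) * (gauged2 1 2 z - inverse c))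
        - (exp (2 * U z (cnj z)) - exp (2 * U z 0)) = ?f z" by simp
  qed (use r in auto)
  moreover have hf: "?f holomorphic_on ?W"
    by (intro holomorphic_intros hU0 holomorphic_on_subset[OF factor_holo r(2)])
  ultimately have "(deriv ^^ n) ?f 0 = 0" for n
    using r by (intro zflat_imp_higher_deriv_0[where W = ?W]) auto
  then have "?f z = 0" by (rule holomorphic_fun_eq_0_on_ball[OF hf z])
  then show ?thesis by simp
qed

end

section \<open>The factors of the frame as an instance\<close>

lemma sigma3_inv: "matrix_inv sigma3 = sigma3"
  by (rule cmat2_inv_eqI) (simp_all add: cmat2_eq_iff matrix_mult_nth2 sigma3_def)

lemma twisted_off_diagonal:
  assumes "g \<in> LambdaSL" "t \<in> sphere 0 1"
  shows "g (- t) $ 1 $ 2 = - g t $ 1 $ 2 \<and> g (- t) $ 2 $ 1 = - g t $ 2 $ 1"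
  using assms unfolding LambdaSL_def sigma3_inv by (auto simp: matrix_mult_nth2 sigma3_def)

lemma continuous_on_cmat2_nth:
  assumes "continuous_on S (g :: 'a::topological_space \<Rightarrow> cmat2)"
  shows "continuous_on S (\<lambda>t. g t $ i $ j)"
  using assms by (intro bounded_linear.continuous_on[OF bounded_linear_vec_nth])

text \<open>The rows of a unitary matrix have length 1.\<close>

lemma unitary_entry_bound:
  fixes M :: cmat2
  assumes "M ** ctranspose M = mat 1"
  shows "norm (M $ i $ j) \<le> 1"
proof -
  have r: "(norm (M $ i $ 1))\<^sup>2 + (norm (M $ i $ 2))\<^sup>2 = 1" for i
  proof -
    have "(M ** ctranspose M) $ i $ i = 1" unfolding assms by (simp add: mat_def)
    then have "M $ i $ 1 * cnj (M $ i $ 1) + M $ i $ 2 * cnj (M $ i $ 2) = 1"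
      unfolding matrix_mult_nth2 ctranspose_def by simp
    then have "complex_of_real ((norm (M $ i $ 1))\<^sup>2 + (norm (M $ i $ 2))\<^sup>2) = of_real 1"
      by (simp only: of_real_add complex_norm_square of_real_1)
    then show ?thesis unfolding of_real_eq_iff .
  qed
  have "(norm (M $ i $ j))\<^sup>2 \<le> 1\<^sup>2"
    using r[of i] exhaust_2[of j] zero_le_power2[of "norm (M $ i $ 1)"] zero_le_power2[of "norm (M $ i $ 2)"]
    by (metis le_add_same_cancel1 le_add_same_cancel2 one_power2)
  then show ?thesis by (rule power2_le_imp_le) simp
qed

text \<open>The inversion moves infinity to the origin, where the limit \<open>I\<close> makes the singularity removable.\<close>

lemma minus_loop_inversion:
  assumes "g \<in> LambdaMinusStarSL"
  shows "\<exists>M. continuous_on (cball 0 1) M \<and> M holomorphic_on ball 0 1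
        \<and> (\<forall>t\<in>sphere 0 1. M t = g (cnj t) $ i $ j) \<and> M 0 = (mat 1 :: cmat2) $ i $ j"
proof -
  obtain G where G: "continuous_on (- ball 0 1) G" "\<And>i j. (\<lambda>t. G t $ i $ j) holomorphic_on - cball 0 1"
    "\<And>t. t \<in> sphere 0 1 \<Longrightarrow> G t = g t" "(G \<longlongrightarrow> mat 1) at_infinity"
    using assms unfolding LambdaMinusStarSL_def by blast
  define M where "M w = (if w = 0 then (mat 1 :: cmat2) $ i $ j else G (inverse w) $ i $ j)" for w
  have inv: "inverse w \<in> - ball 0 1" if "w \<in> cball 0 1 - {0}" for w :: complex
    using that one_le_inverse[of "norm w"] by (simp add: norm_inverse not_less)
  have inv': "inverse w \<in> - cball 0 1" if "w \<in> ball 0 1 - {0}" for w :: complex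
    using that by (simp add: norm_inverse one_less_inverse_iff not_le)
  have Mc: "continuous_on (cball 0 1) M"
    unfolding continuous_on_eq_continuous_within
  proof
    fix w :: complex assume w: "w \<in> cball 0 1"
    show "continuous (at w within cball 0 1) M"
    proof (cases "w = 0")
      case True
      have "((\<lambda>w. G (inverse w)) \<longlongrightarrow> mat 1) (at 0)"
        by (rule filterlim_compose[OF G(4) filterlim_inverse_at_infinity])
      then have "((\<lambda>w. G (inverse w) $ i $ j) \<longlongrightarrow> (mat 1 :: cmat2) $ i $ j) (at 0)"
        by (intro tendsto_vec_nth)
      moreover have "\<forall>\<^sub>F w in at 0. G (inverse w) $ i $ j = M w"
        by (auto simp: M_def eventually_at_filter)
      ultimately have "(M \<longlongrightarrow> (mat 1 :: cmat2) $ i $ j) (at 0)"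
        by (rule Lim_transform_eventually)
      then have "(M \<longlongrightarrow> M 0) (at 0)" by (simp add: M_def)
      then show ?thesis unfolding True continuous_within by (rule tendsto_within_subset) simp
    next
      case False
      have "continuous_on (cball 0 1 - {0}) (\<lambda>w. G (inverse w) $ i $ j)"
        by (rule continuous_on_cmat2_nth, rule continuous_on_compose2[OF G(1)])
          (use inv in \<open>auto intro!: continuous_intros\<close>)
      then have "continuous_on (cball 0 1 - {0}) M" by (rule continuous_on_eq) (auto simp: M_def)
      then have "continuous (at w within cball 0 1 - {0}) M" using w False by (simp add: continuous_on_eq_continuous_within)
      moreover have "at w within cball 0 1 - {0} = at w within cball 0 1"
        by (rule at_within_nhd[of _ "- {0}"]) (use False in auto)
      ultimately show ?thesis by (simp add: continuous_within)
    qed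
  qed
  have "inverse holomorphic_on ball 0 1 - {0 :: complex}"
    using holomorphic_on_inverse[OF holomorphic_on_ident, of "ball 0 1 - {0}"] by auto
  moreover have "inverse ` (ball 0 1 - {0}) \<subseteq> - cball (0::complex) 1"
    using inv' by blast
  ultimately have "((\<lambda>t. G t $ i $ j) \<circ> inverse) holomorphic_on ball 0 1 - {0}"
    by (rule holomorphic_on_compose_gen[OF _ G(2)])
  then have "(\<lambda>w. G (inverse w) $ i $ j) holomorphic_on ball 0 1 - {0}" by (simp add: comp_def)
  then have "M holomorphic_on ball 0 1 - {0}" by (rule holomorphic_transform) (auto simp: M_def)
  then have Mh: "M holomorphic_on ball 0 1"
    by (rule no_isolated_singularity[OF continuous_on_subset[OF Mc ball_subset_cball] _ open_ball]) simp
  have "M t = g (cnj t) $ i $ j" if t: "t \<in> sphere 0 1" for t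
  proof -
    have "inverse t = cnj t" using t complex_norm_square[of t] by (auto intro!: inverse_unique)
    moreover have "t \<noteq> 0" using t by auto
    ultimately show ?thesis using G(3)[of "cnj t"] t by (simp add: M_def)
  qed
  then show ?thesis using Mc Mh by (intro exI[of _ M]) (auto simp: M_def)
qed

lemma loop_splitting_of_normalized_potential:
  assumes D: "open D" and f: "conformal_immersion D f u" and N: "unit_normal D f N"
    and Q: "\<forall>z\<in>D. Q z = hopf f N z" and H: "\<bar>H\<bar> > 1"
    and F: "adjusted_frame D u Q H F" and np: "normalized_potential D S F P"
  obtains Fm Fp where "loop_splitting (D - S) u Q (of_real (sqrt (H\<^sup>2 - 1)))
    (wirt (\<lambda>w. of_real (u w))) (wirt_bar (\<lambda>w. of_real (u w))) F Fm Fp P"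
proof -
  from np obtain Fm Fp :: "complex \<Rightarrow> complex \<Rightarrow> cmat2" where
      S: "S \<subseteq> D - {0}" "S sparse_in D" and
      cm: "continuous_on ((D - S) \<times> sphere 0 1) (\<lambda>(z, t). Fm z t)" and
      mem: "\<And>z. z \<in> D - S \<Longrightarrow> Fm z \<in> LambdaMinusStarSL" "\<And>z. z \<in> D - S \<Longrightarrow> Fp z \<in> LambdaPlusSL" and
      fac: "\<And>z t. z \<in> D - S \<Longrightarrow> t \<in> sphere 0 1 \<Longrightarrow> F z t = Fm z t ** Fp z t" and
      dm: "\<And>z t. z \<in> D - S \<Longrightarrow> t \<in> sphere 0 1 \<Longrightarrow> (\<lambda>\<zeta>. Fm \<zeta> t) differentiable (at z)" and
      mc: "\<And>z t v. z \<in> D - S \<Longrightarrow> t \<in> sphere 0 1 \<Longrightarrow>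
         cscale t (maurer_cartan (\<lambda>\<zeta>. Fm \<zeta> t) z v) = cscale v (P z t)"
    unfolding normalized_potential_def by blast
  have SL: "Fm z \<in> LambdaSL" "Fp z \<in> LambdaSL" if "z \<in> D - S" for z
    using mem[OF that] by (auto simp: LambdaMinusStarSL_def LambdaPlusSL_def)
  have FSU: "F z \<in> LambdaSU" if "z \<in> D" for z using F that by (auto simp: adjusted_frame_def)
  have FSL: "F z \<in> LambdaSL" if "z \<in> D" for z using FSU[OF that] by (simp add: LambdaSU_def)
  have C1: "Ck_on (Suc 0) D (\<lambda>z. complex_of_real (u z))" by (rule conformal_factor_C1[OF D f])
  show thesis
  proof (rule that, unfold_locales)
    show "open (D - S)" by (rule open_diff_sparse_pts[OF D S(2)])
    have "1 < H\<^sup>2" using H by (simp add: power2_eq_square abs_less_iff flip: abs_square_less_1) (metis abs_ge_zero abs_mult_self_eq less_1_mult)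
    then show "complex_of_real (sqrt (H\<^sup>2 - 1)) \<noteq> 0" by simp
    have "continuous_on D (wirt (\<lambda>w. of_real (u w)))" "continuous_on D (wirt_bar (\<lambda>w. of_real (u w)))"
      using Ck_on_wirt[OF C1 D] by simp_all
    then show "continuous_on (D - S) (wirt (\<lambda>w. of_real (u w)))" "continuous_on (D - S) (wirt_bar (\<lambda>w. of_real (u w)))"
      by (blast intro: continuous_on_subset)+
    have "continuous_on D Q"
      by (rule continuous_on_eq[OF hopf_continuous[OF D f N]]) (use Q in auto)
    then show "continuous_on (D - S) Q" by (blast intro: continuous_on_subset)
    show "continuous_on ((D - S) \<times> sphere 0 1) (\<lambda>(z,t). Fm z t $ i $ j)" for i j
      using continuous_on_cmat2_nth[OF cm] by (simp add: case_prod_unfold)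
  next
    fix z assume z: "z \<in> D - S"
    then have zD: "z \<in> D" by blast
    show "has_dz (\<lambda>w. of_real (u w)) (wirt (\<lambda>w. of_real (u w)) z) (wirt_bar (\<lambda>w. of_real (u w)) z) z"
      by (rule has_dz_wirt[OF Ck_on_differentiable[OF C1 zD]])
    show "continuous_on (sphere 0 1) (\<lambda>t. F z t $ i $ j)" for i j
      using FSL[OF zD] by (auto simp: LambdaSL_def intro: continuous_on_cmat2_nth)
    show "disk_loop (\<lambda>t. Fp z t $ i $ j)" for i j
    proof -
      obtain G where "continuous_on (cball 0 1) G" "\<forall>i j. (\<lambda>t. G t $ i $ j) holomorphic_on ball 0 1"
        "\<forall>t\<in>sphere 0 1. G t = Fp z t"
        using mem(2)[OF z] unfolding LambdaPlusSL_def by blast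
      then show ?thesis
        by (intro disk_loopI[of "\<lambda>t. G t $ i $ j"] continuous_on_cmat2_nth) auto
    qed
    show "\<exists>G. continuous_on (cball 0 1) G \<and> G holomorphic_on ball 0 1
        \<and> (\<forall>t\<in>sphere 0 1. G t = Fm z (cnj t) $ i $ j) \<and> G 0 = (mat 1 :: cmat2) $ i $ j" for i j
      by (rule minus_loop_inversion[OF mem(1)[OF z]])
    fix t :: complex assume t: "t \<in> sphere 0 1"
    have t0: "t \<noteq> 0" using t by auto
    show detm: "det (Fm z t) = 1" and "det (Fp z t) = 1"
      using SL[OF z] t by (auto simp: LambdaSL_def)
    show "F z t = Fm z t ** Fp z t" by (rule fac[OF z t])
    show "Fp z (- t) $ 1 $ 2 = - Fp z t $ 1 $ 2 \<and> Fp z (- t) $ 2 $ 1 = - Fp z t $ 2 $ 1"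
      by (rule twisted_off_diagonal[OF SL(2)[OF z] t])
    show "norm (F z t $ i $ j) \<le> 1" for i j
      using FSU[OF zD] t by (intro unitary_entry_bound) (auto simp: LambdaSU_def)
    have "has_mdz (\<lambda>\<zeta>. Fm \<zeta> t) (Fm z t ** cscale (inverse t) (P z t)) (Fm z t ** 0) z"
    proof (rule has_mdz_maurer_cartan[OF dm[OF z t] detm])
      fix v
      have "cscale (inverse t) (cscale t (maurer_cartan (\<lambda>\<zeta>. Fm \<zeta> t) z v)) = cscale (inverse t) (cscale v (P z t))"
        unfolding mc[OF z t] ..
      then show "maurer_cartan (\<lambda>\<zeta>. Fm \<zeta> t) z v = cscale v (cscale (inverse t) (P z t)) + cscale (cnj v) 0"
        using t0 by (simp add: vec_eq_iff mult.left_commute flip: mult.assoc)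
    qed
    then show "has_mdz (\<lambda>\<zeta>. Fm \<zeta> t) (Fm z t ** cscale (inverse t) (P z t)) 0 z" by simp
    show "has_mdz (\<lambda>\<zeta>. F \<zeta> t)
        (F z t ** mat2 (- wirt (\<lambda>w. of_real (u w)) z / 2) (- inverse t * of_real (exp (- u z)) * Q z)
                 (inverse t * of_real (exp (u z)) / 2 * of_real (sqrt (H\<^sup>2 - 1))) (wirt (\<lambda>w. of_real (u w)) z / 2))
        (F z t ** mat2 (wirt_bar (\<lambda>w. of_real (u w)) z / 2) (- t * of_real (exp (u z)) / 2 * of_real (sqrt (H\<^sup>2 - 1)))
                 (t * of_real (exp (- u z)) * cnj (Q z)) (- wirt_bar (\<lambda>w. of_real (u w)) z / 2)) z"
    proof (rule has_mdz_maurer_cartan)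
      show "(\<lambda>\<zeta>. F \<zeta> t) differentiable (at z)" using F zD t by (auto simp: adjusted_frame_def)
      show "det (F z t) = 1" using FSL[OF zD] t by (auto simp: LambdaSL_def)
      fix v
      have "maurer_cartan (\<lambda>\<zeta>. F \<zeta> t) z v = adjusted_form u Q H t z v"
        using F zD t by (auto simp: adjusted_frame_def)
      then show "maurer_cartan (\<lambda>\<zeta>. F \<zeta> t) z v
        = cscale v (mat2 (- wirt (\<lambda>w. of_real (u w)) z / 2) (- inverse t * of_real (exp (- u z)) * Q z)
                 (inverse t * of_real (exp (u z)) / 2 * of_real (sqrt (H\<^sup>2 - 1))) (wirt (\<lambda>w. of_real (u w)) z / 2))
        + cscale (cnj v) (mat2 (wirt_bar (\<lambda>w. of_real (u w)) z / 2) (- t * of_real (exp (u z)) / 2 * of_real (sqrt (H\<^sup>2 - 1)))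
                 (t * of_real (exp (- u z)) * cnj (Q z)) (- wirt_bar (\<lambda>w. of_real (u w)) z / 2))"
        by (simp only: adjusted_form_def Let_def)
    qed
  qed
qed

section \<open>The normalized potential\<close>

theorem mainTheorem5:
  fixes D S V :: "complex set"
    and f N :: "complex \<Rightarrow> real^4"
    and u :: "complex \<Rightarrow> real"
    and Q h :: "complex \<Rightarrow> complex"
    and H :: real
    and F P :: "complex \<Rightarrow> complex \<Rightarrow> cmat2"
  assumes "open D" and "simply_connected D" and "0 \<in> D"
    and "conformal_immersion D f u"
    and "unit_normal D f N"
    and "\<forall>z\<in>D. Q z = hopf f N z"
    and "has_mean_curvature D f N u (\<lambda>_. H)"
    and "\<bar>H\<bar> > 1"
    and "adjusted_frame D u Q H F"
    and "normalized_potential D S F P"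
    and "holomorphic_part D u V h"
  shows "(\<forall>z\<in>V - S. \<forall>\<theta>\<in>sphere 0 1. P z \<theta> =
            mat2 0 (- exp (- 2 * h z + h 0) * Q z)
                 (exp (2 * h z - h 0) / 2 * of_real (sqrt (H\<^sup>2 - 1))) 0)
    \<and> (\<exists>E. E meromorphic_on D
          \<and> E analytic_on D - S
          \<and> (\<forall>z\<in>D - S. E z \<noteq> 0)
          \<and> (\<forall>z\<in>V. E z = exp (2 * h z))
          \<and> (\<forall>z\<in>D - S. \<forall>\<theta>\<in>sphere 0 1. P z \<theta> =
               mat2 0 (- exp (h 0) / E z * Q z)
                    (E z * exp (- h 0) / 2 * of_real (sqrt (H\<^sup>2 - 1))) 0))"
proof -
  obtain Fm Fp where split: "loop_splitting (D - S) u Q (of_real (sqrt (H\<^sup>2 - 1)))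
    (wirt (\<lambda>w. of_real (u w))) (wirt_bar (\<lambda>w. of_real (u w))) F Fm Fp P"
    using loop_splitting_of_normalized_potential assms by metis
  interpret loop_splitting "D - S" u Q "of_real (sqrt (H\<^sup>2 - 1))" "wirt (\<lambda>w. of_real (u w))"
      "wirt_bar (\<lambda>w. of_real (u w))" F Fm Fp P
    by (rule split)
  have S: "S \<subseteq> D - {0}" "S sparse_in D" and mer: "(\<lambda>z. P z 1 $ 2 $ 1) meromorphic_on D"
    using assms(10) by (auto simp: normalized_potential_def)
  have V: "open V" "connected V" "0 \<in> V" "V \<subseteq> D" "h holomorphic_on V"
    using assms(11) by (auto simp: holomorphic_part_def)
  obtain e U where e: "e > 0" "ball 0 e \<subseteq> V" and "sep_holo e U"
    and U: "\<And>z. z \<in> ball 0 e \<Longrightarrow> U z (cnj z) = of_real (u z)" "\<And>z. z \<in> ball 0 e \<Longrightarrow> h z = U z 0"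
    using assms(11) unfolding holomorphic_part_def sep_holo_def by blast
  have "0 \<in> D - S" using S assms(3) by blast
  then obtain r0 where r0: "r0 > 0" "ball 0 r0 \<subseteq> D - S" using open_A by (meson open_contains_ball)
  define r where "r = min e r0"
  have r: "r > 0" "ball 0 r \<subseteq> D - S" "ball 0 r \<subseteq> ball (0::complex) e"
    using e r0 by (auto simp: r_def)
  have h0: "h 0 = of_real (u 0)" using U[of 0] e by simp
  have near0: "exp (2 * h z) = exp (h 0) * factor z" if z: "z \<in> ball 0 r" for z
  proof -
    have "exp (2 * U z 0) = exp (of_real (u 0)) * factor z"
    proof (rule factor_eq_holomorphic_part[OF _ r(1,2) _ _ z])
      show "F 0 t = mat 1" if "t \<in> sphere 0 1" for t
        using assms(9) that by (auto simp: adjusted_frame_def)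
      show "sep_holo r U" using \<open>sep_holo e U\<close> by (rule sep_holo_subset) (simp add: r_def)
    qed (use U r in auto)
    then show ?thesis using U(2)[of z] z r h0 by auto
  qed
  have eqV: "exp (2 * h z) = exp (h 0) * factor z" if z: "z \<in> V - S" for z
  proof (rule analytic_continuation_open[where s = "ball 0 r" and s' = "V - S"
        and f = "\<lambda>z. exp (2 * h z)" and g = "\<lambda>z. exp (h 0) * factor z"])
    show "open (V - S)" "connected (V - S)"
      using V S sparse_in_subset[OF S(2) V(4)] by (auto intro!: open_diff_sparse_pts sparse_imp_connected)
    show "ball 0 r \<subseteq> V - S" using r e by blast
    show "(\<lambda>z. exp (2 * h z)) holomorphic_on V - S"
      using V(5) by (auto intro!: holomorphic_intros intro: holomorphic_on_subset)
    show "(\<lambda>z. exp (h 0) * factor z) holomorphic_on V - S"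
      using V(4) by (intro holomorphic_intros holomorphic_on_subset[OF factor_holo]) auto
  qed (use r near0 z in auto)
  \<comment> \<open>The values of \<open>e\<^bsup>h(0)\<^esup> p\<close> at the points of \<open>S\<close> in \<open>V\<close> are arbitrary and have to be replaced.\<close>
  define E where "E z = (if z \<in> V then exp (2 * h z) else exp (h 0) * factor z)" for z
  have E_eq: "E z = exp (h 0) * factor z" if "z \<notin> S" for z
    using eqV that by (auto simp: E_def)
  have E_mer: "E meromorphic_on D"
  proof -
    have m: "(\<lambda>z. exp (h 0) * factor z) meromorphic_on D"
      unfolding factor_def by (intro meromorphic_intros mer)
    have ev: "eventually (\<lambda>z. exp (h 0) * factor z = E z) (cosparse D)"
      unfolding eventually_cosparse by (rule sparse_in_subset2[OF S(2)]) (metis (mono_tags, lifting) E_eq mem_Collect_eq subsetI)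
    show ?thesis by (rule iffD1[OF meromorphic_on_cong'[OF ev refl] m])
  qed
  have "(\<lambda>z. exp (h 0) * factor z) holomorphic_on D - S" by (intro holomorphic_intros factor_holo)
  then have "E holomorphic_on D - S" by (rule holomorphic_transform) (simp add: E_eq)
  then have E_an: "E analytic_on D - S" using open_A by (simp add: analytic_on_open)
  have P: "P z \<theta> = mat2 0 (- exp (h 0) / E z * Q z) (E z * exp (- h 0) / 2 * of_real (sqrt (H\<^sup>2 - 1))) 0"
    if "z \<in> D - S" "\<theta> \<in> sphere 0 1" for z \<theta>
    using P_eq[OF that] that E_eq[of z] factor_nonzero[OF that(1)]
    by (simp add: exp_minus field_simps)
  have "P z \<theta> = mat2 0 (- exp (- 2 * h z + h 0) * Q z)
                 (exp (2 * h z - h 0) / 2 * of_real (sqrt (H\<^sup>2 - 1))) 0"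
    if "z \<in> V - S" "\<theta> \<in> sphere 0 1" for z \<theta>
  proof -
    have "exp (h 0) / E z = exp (- 2 * h z + h 0)" "E z * exp (- h 0) = exp (2 * h z - h 0)"
      using that by (simp_all add: E_def flip: exp_diff exp_add)
    then show ?thesis using P[of z \<theta>] that V(4) by auto
  qed
  moreover have "E z \<noteq> 0" if "z \<in> D - S" for z using that E_eq[of z] factor_nonzero[OF that] by simp
  moreover have "E z = exp (2 * h z)" if "z \<in> V" for z using that by (simp add: E_def)
  ultimately show ?thesis using E_mer E_an P by blast
qed

end
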